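(* The octonionic Hessian complex $$0\to \Gamma(\Omega,\mathcal V_0)\xrightarrow{\mathcal D_0}\Gamma(\Omega,\mathcal V_1)\xrightarrow{\mathcal D_1}\Gamma(\Omega,\mathcal V_2)\xrightarrow{\mathcal D_2}\Gamma(\Omega,\mathcal V_3)\xrightarrow{\mathcal D_3}\Gamma(\Omega,\mathcal V_4)\xrightarrow{\mathcal D_4}\Gamma(\Omega,\mathcal V_5)\to 0$$ on a domain $\Omega\subset\mathbb O^2$ is elliptic. That is, for every $\xi\in\mathbb O^2\setminus\{\mathbf 0\}$ the symbol sequence $$0\to \mathbb C\xrightarrow{\sigma_0(\xi)}\mathcal H_2(\mathbb O_{\mathbb C})\xrightarrow{\sigma_1(\xi)}\mathbb O_{\mathbb C}^2\xrightarrow{\sigma_2(\xi)}\mathbb O_{\mathbb C}^2\xrightarrow{\sigma_3(\xi)}\mathcal H_2(\mathbb O_{\mathbb C})\xrightarrow{\sigma_4(\xi)}\mathbb C\to 0$$ is exact, where $\sigma_j(\xi)$ is the symbol of $\mathcal D_j$.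
   Context: Octonions: $\mathbb O$ is the real octonion algebra with basis $e_0=1,e_1,\dots,e_7$, $e_a^2=-1$ and $e_ae_b=-e_be_a$ for $a\ne b$ in $\{1,\dots,7\}$; writing $\mathbb O=\mathbb H\oplus\mathbb H e_4$, the product is $(a,b)(c,d)=(ac-\bar d b,\,da+b\bar c)$. Conjugation: $\bar e_0=e_0$, $\bar e_a=-e_a$ for $a\ge1$, extended linearly. $\mathbb O_{\mathbb C}=\mathbb O\otimes_{\mathbb R}\mathbb C$, with conjugation extended $\mathbb C$-linearly; for $x=\sum_a z_ae_a$, $\operatorname{Re}x=z_0$ and $\operatorname{Im}x=\sum_{a\ge1}z_ae_a$. For $\mathbb F=\mathbb R$ or $\mathbb C$, $\mathcal H_2(\mathbb O_{\mathbb F})=\{\begin{pmatrix}a&q\\ \bar q&b\end{pmatrix}: a,b\in\mathbb F,\ q\in\mathbb O_{\mathbb F}\}$, with $\mathbb O_{\mathbb R}=\mathbb O$. Entries of $u\in\mathcal H_2$ are written $u=(u_{\bar ij})_{i,j=1,2}$. Points of $\mathbb O^2\cong\mathbb R^{16}$ are $(x_1,x_2)$ with $x_j=\sum_{a=0}^7x_j^ae_a$. For an $\mathbb O$-valued function $F$, $$\partial_{\bar j}F=\sum_a e_a\frac{\partial F}{\partial x_j^a},\quad \partial_jF=\sum_a\bar e_a\frac{\partial F}{\partial x_j^a},\quad F\overleftarrow{\partial_{\bar j}}=\sum_a\frac{\partial F}{\partial x_j^a}e_a,\quad F\overleftarrow{\partial_j}=\sum_a\frac{\partial F}{\partial x_j^a}\bar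 e_a,$$ and $(\partial_{\bar i}\partial_j)F=\sum_{a,b}(e_a\bar e_b)\frac{\partial^2F}{\partial x_i^a\partial x_j^b}$; $\Delta_j=\sum_{a=0}^7\partial^2/\partial (x_j^a)^2$. $\mathcal V_0=\mathcal V_5=\mathbb R$, $\mathcal V_1=\mathcal V_4=\mathcal H_2(\mathbb O)$, $\mathcal V_2=\mathcal V_3=\mathbb O^2$; $\Gamma(\Omega,\mathcal V_j)$ denotes smooth $\mathcal V_j$-valued functions. The operators are $$\mathcal D_0f=\begin{pmatrix}\Delta_1f&\partial_{\bar1}\partial_2f\\ \partial_{\bar2}\partial_1f&\Delta_2f\end{pmatrix},\qquad \mathcal D_1u=\begin{pmatrix}u_{\bar12}\overleftarrow{\partial_{\bar2}}-\partial_{\bar1}u_{\bar22}\\ u_{\bar21}\overleftarrow{\partial_{\bar1}}-\partial_{\bar2}u_{\bar11}\end{pmatrix},$$ $$\mathcal D_2v=\begin{pmatrix}(\partial_{\bar1}\partial_2)v_2-(\partial_{\bar1}\bar v_2)\overleftarrow{\partial_{\bar2}}+2\operatorname{Im}(v_1\overleftarrow{\partial_1})\overleftarrow{\partial_{\bar1}}\\ (\partial_{\bar2}\partial_1)v_1-(\partial_{\bar2}\bar v_1)\overleftarrow{\partial_{\bar1}}+2\operatorname{Im}(v_2\overleftarrow{\partial_2})\overleftarrow{\partial_{\bar2}}\end{pmatrix},$$ $$\mathcal D_3t=\begin{pmatrix}\operatorname{Re}(\partial_2t_2)&-\frac{\partial_{\bar1}\bar t_2+t_1\overleftarrow{\partial_2}}2\\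 -\frac{t_2\overleftarrow{\partial_1}+\partial_{\bar2}\bar t_1}2&\operatorname{Re}(\partial_1t_1)\end{pmatrix},\qquad \mathcal D_4s=\Delta_1s_{\bar11}+\Delta_2s_{\bar22}+2\operatorname{Re}(\partial_2s_{\bar21}\overleftarrow{\partial_{\bar1}}).$$ Symbols: for $\xi=(\xi_1,\xi_2)\in\mathbb O^2$, $\xi_j=\sum_a\xi_j^ae_a$, the symbol $\sigma_j(\xi)$ is the $\mathbb C$-linear map obtained from the constant-coefficient operator $\mathcal D_j$ by replacing each $\partial/\partial x_k^a$ by $\mathbf i\,\xi_k^a$ (where $\mathbf i$ is the imaginary unit of $\mathbb C$, commuting with all $e_a$), acting between the complexifications of $\mathcal V_j$ and $\mathcal V_{j+1}$, with conjugation, $\operatorname{Re}$ and $\operatorname{Im}$ extended $\mathbb C$-linearly. Equivalently $\sigma_j(\xi)\hat f=\widehat{\mathcal D_jf}(\xi)$ with $\hat f(\xi)=\int f(x)e^{-\mathbf i\langle x,\xi\rangle}dx$. *)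

theory Defs
  imports "HOL-Analysis.Analysis"
begin

section \<open>Octonions with coefficients in a field\<close>

datatype 'a quat = Quat (quat0: 'a) (quat1: 'a) (quat2: 'a) (quat3: 'a)

instantiation quat :: (ring) "{plus, minus, times}"
begin

definition plus_quat :: "'a quat \<Rightarrow> 'a quat \<Rightarrow> 'a quat" where
  "p + q = Quat (quat0 p + quat0 q) (quat1 p + quat1 q) (quat2 p + quat2 q) (quat3 p + quat3 q)"

definition minus_quat :: "'a quat \<Rightarrow> 'a quat \<Rightarrow> 'a quat" where
  "p - q = Quat (quat0 p - quat0 q) (quat1 p - quat1 q) (quat2 p - quat2 q) (quat3 p - quat3 q)"

definition times_quat :: "'a quat \<Rightarrow> 'a quat \<Rightarrow> 'a quat" where
  "p * q = Quat
    (quat0 p * quat0 q - quat1 p * quat1 q - quat2 p * quat2 q - quat3 p * quat3 q)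
    (quat0 p * quat1 q + quat1 p * quat0 q + quat2 p * quat3 q - quat3 p * quat2 q)
    (quat0 p * quat2 q - quat1 p * quat3 q + quat2 p * quat0 q + quat3 p * quat1 q)
    (quat0 p * quat3 q + quat1 p * quat2 q - quat2 p * quat1 q + quat3 p * quat0 q)"

instance ..

end

definition qcnj :: "'a::ring quat \<Rightarrow> 'a quat" where
  "qcnj p = Quat (quat0 p) (- quat1 p) (- quat2 p) (- quat3 p)"

text \<open>
  An octonion is the vector of its coordinates with respect to \<open>e\<^sub>0, \<dots>, e\<^sub>7\<close>, the index
  type \<open>8\<close> having the elements \<open>0, \<dots>, 7\<close>. Thus \<open>real oct\<close> is the real octonion algebra and
  \<open>complex oct\<close> its complexification. The octonion product is \<open>\<odot>\<close>; the product \<open>*\<close> that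
  the library puts on vectors is the componentwise one and is not used.
\<close>

type_synonym 'a oct = "'a^8"

definition oe :: "8 \<Rightarrow> 'a::zero_neq_one oct" where
  "oe a = axis a 1"

definition olow :: "'a oct \<Rightarrow> 'a quat" where
  "olow x = Quat (x $ 0) (x $ 1) (x $ 2) (x $ 3)"

definition ohigh :: "'a oct \<Rightarrow> 'a quat" where
  "ohigh x = Quat (x $ 4) (x $ 5) (x $ 6) (x $ 7)"

text \<open>
  \<open>opair p q\<close> is \<open>(p, q) = p + q e\<^sub>4\<close>, where \<open>e\<^sub>1, e\<^sub>2, e\<^sub>3\<close> are the quaternion units and
  \<open>e\<^sub>4\<^sub>+\<^sub>k = e\<^sub>k e\<^sub>4\<close>.
\<close>

definition opair :: "'a::comm_ring_1 quat \<Rightarrow> 'a quat \<Rightarrow> 'a oct" where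
  "opair p q =
     quat0 p *s oe 0 + quat1 p *s oe 1 + quat2 p *s oe 2 + quat3 p *s oe 3
   + quat0 q *s oe 4 + quat1 q *s oe 5 + quat2 q *s oe 6 + quat3 q *s oe 7"

definition omult :: "'a::comm_ring_1 oct \<Rightarrow> 'a oct \<Rightarrow> 'a oct" (infixl \<open>\<odot>\<close> 70) where
  "x \<odot> y =
     opair (olow x * olow y - qcnj (ohigh y) * ohigh x)
           (ohigh y * olow x + ohigh x * qcnj (olow y))"

text \<open>Over the complex numbers this is the complex-linear extension of the conjugation.\<close>

definition ocnj :: "'a::comm_ring_1 oct \<Rightarrow> 'a oct" where
  "ocnj x = (\<chi> a. if a = 0 then x $ a else - (x $ a))"

definition oRe :: "'a oct \<Rightarrow> 'a" where
  "oRe x = x $ 0"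

definition oIm :: "'a::zero oct \<Rightarrow> 'a oct" where
  "oIm x = (\<chi> a. if a = 0 then 0 else x $ a)"

definition oscalar :: "'a::zero \<Rightarrow> 'a oct" where
  "oscalar c = axis 0 c"

definition H2 :: "('a::comm_ring_1 oct^2^2) set" where
  "H2 = {vector [vector [oscalar a, q], vector [ocnj q, oscalar b]] | a b q. True}"


section \<open>The operators\<close>

text \<open>
  The operators are written as formulas in an arbitrary family \<open>d\<close>, where \<open>d j a\<close> acts on
  scalar functions and stands for \<open>\<partial>/\<partial>x\<^sub>j\<^sup>a\<close>. With \<open>d = pd\<close>, the partial derivatives,
  one gets the differential operators; with \<open>d = symb \<xi>\<close>, multiplication by
  \<open>\<i> \<xi>\<^sub>j\<^sup>a\<close>, one gets their symbols. The index \<open>j :: 2\<close> takes the values \<open>1\<close> and \<open>2\<close>.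
\<close>

type_synonym ('x, 'a) partials = "2 \<Rightarrow> 8 \<Rightarrow> ('x \<Rightarrow> 'a) \<Rightarrow> ('x \<Rightarrow> 'a)"

definition odiff :: "('x, 'a) partials \<Rightarrow> 2 \<Rightarrow> 8 \<Rightarrow> ('x \<Rightarrow> 'a oct) \<Rightarrow> 'x \<Rightarrow> 'a oct" where
  "odiff d j a F = (\<lambda>x. \<chi> b. d j a (\<lambda>y. F y $ b) x)"

text \<open>
  \<open>dbar\<close> and \<open>dunbar\<close> are \<open>\<partial>\<close> with index \<open>j\<close> barred and unbarred, acting from the left;
  \<open>rdbar\<close> and \<open>rdunbar\<close> are the same acting from the right.
\<close>

definition dbar :: "('x, 'a::comm_ring_1) partials \<Rightarrow> 2 \<Rightarrow> ('x \<Rightarrow> 'a oct) \<Rightarrow> 'x \<Rightarrow> 'a oct" where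
  "dbar d j F = (\<lambda>x. \<Sum>a\<in>UNIV. oe a \<odot> odiff d j a F x)"

definition dunbar :: "('x, 'a::comm_ring_1) partials \<Rightarrow> 2 \<Rightarrow> ('x \<Rightarrow> 'a oct) \<Rightarrow> 'x \<Rightarrow> 'a oct" where
  "dunbar d j F = (\<lambda>x. \<Sum>a\<in>UNIV. ocnj (oe a) \<odot> odiff d j a F x)"

definition rdbar :: "('x, 'a::comm_ring_1) partials \<Rightarrow> 2 \<Rightarrow> ('x \<Rightarrow> 'a oct) \<Rightarrow> 'x \<Rightarrow> 'a oct" where
  "rdbar d j F = (\<lambda>x. \<Sum>a\<in>UNIV. odiff d j a F x \<odot> oe a)"

definition rdunbar :: "('x, 'a::comm_ring_1) partials \<Rightarrow> 2 \<Rightarrow> ('x \<Rightarrow> 'a oct) \<Rightarrow> 'x \<Rightarrow> 'a oct" where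
  "rdunbar d j F = (\<lambda>x. \<Sum>a\<in>UNIV. odiff d j a F x \<odot> ocnj (oe a))"

text \<open>
  The second-order operator with index \<open>i\<close> barred and \<open>j\<close> unbarred. By non-associativity it is
  not the composition of \<open>dbar d i\<close> and \<open>dunbar d j\<close>.
\<close>

definition dmixed ::
    "('x, 'a::comm_ring_1) partials \<Rightarrow> 2 \<Rightarrow> 2 \<Rightarrow> ('x \<Rightarrow> 'a oct) \<Rightarrow> 'x \<Rightarrow> 'a oct" where
  "dmixed d i j F =
     (\<lambda>x. \<Sum>a\<in>UNIV. \<Sum>b\<in>UNIV. (oe a \<odot> ocnj (oe b)) \<odot> odiff d i a (odiff d j b F) x)"

definition laplace :: "('x, 'a::comm_ring_1) partials \<Rightarrow> 2 \<Rightarrow> ('x \<Rightarrow> 'a) \<Rightarrow> 'x \<Rightarrow> 'a" where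
  "laplace d j f = (\<lambda>x. \<Sum>a\<in>UNIV. d j a (d j a f) x)"

definition D0 :: "('x, 'a::real_normed_field) partials \<Rightarrow> ('x \<Rightarrow> 'a) \<Rightarrow> 'x \<Rightarrow> 'a oct^2^2" where
  "D0 d f = (\<lambda>x. vector
     [vector [oscalar (laplace d 1 f x), dmixed d 1 2 (\<lambda>y. oscalar (f y)) x],
      vector [dmixed d 2 1 (\<lambda>y. oscalar (f y)) x, oscalar (laplace d 2 f x)]])"

definition D1 ::
    "('x, 'a::real_normed_field) partials \<Rightarrow> ('x \<Rightarrow> 'a oct^2^2) \<Rightarrow> 'x \<Rightarrow> 'a oct^2" where
  "D1 d u = (\<lambda>x. vector
     [rdbar d 2 (\<lambda>y. u y $ 1 $ 2) x - dbar d 1 (\<lambda>y. u y $ 2 $ 2) x,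
      rdbar d 1 (\<lambda>y. u y $ 2 $ 1) x - dbar d 2 (\<lambda>y. u y $ 1 $ 1) x])"

definition D2 ::
    "('x, 'a::real_normed_field) partials \<Rightarrow> ('x \<Rightarrow> 'a oct^2) \<Rightarrow> 'x \<Rightarrow> 'a oct^2" where
  "D2 d v = (\<lambda>x. vector
     [dmixed d 1 2 (\<lambda>y. v y $ 2) x
        - rdbar d 2 (dbar d 1 (\<lambda>y. ocnj (v y $ 2))) x
        + 2 *\<^sub>R rdbar d 1 (\<lambda>y. oIm (rdunbar d 1 (\<lambda>z. v z $ 1) y)) x,
      dmixed d 2 1 (\<lambda>y. v y $ 1) x
        - rdbar d 1 (dbar d 2 (\<lambda>y. ocnj (v y $ 1))) x
        + 2 *\<^sub>R rdbar d 2 (\<lambda>y. oIm (rdunbar d 2 (\<lambda>z. v z $ 2) y)) x])"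

definition D3 ::
    "('x, 'a::real_normed_field) partials \<Rightarrow> ('x \<Rightarrow> 'a oct^2) \<Rightarrow> 'x \<Rightarrow> 'a oct^2^2" where
  "D3 d t = (\<lambda>x. vector
     [vector
       [oscalar (oRe (dunbar d 2 (\<lambda>y. t y $ 2) x)),
        - ((1/2) *\<^sub>R (dbar d 1 (\<lambda>y. ocnj (t y $ 2)) x + rdunbar d 2 (\<lambda>y. t y $ 1) x))],
      vector
       [- ((1/2) *\<^sub>R (rdunbar d 1 (\<lambda>y. t y $ 2) x + dbar d 2 (\<lambda>y. ocnj (t y $ 1)) x)),
        oscalar (oRe (dunbar d 1 (\<lambda>y. t y $ 1) x))]])"

text \<open>The diagonal entries of an element of \<open>H2\<close> are scalars, which \<open>oRe\<close> extracts.\<close>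

definition D4 :: "('x, 'a::real_normed_field) partials \<Rightarrow> ('x \<Rightarrow> 'a oct^2^2) \<Rightarrow> 'x \<Rightarrow> 'a" where
  "D4 d s = (\<lambda>x.
     laplace d 1 (\<lambda>y. oRe (s y $ 1 $ 1)) x + laplace d 2 (\<lambda>y. oRe (s y $ 2 $ 2)) x
       + 2 * oRe (rdbar d 1 (dunbar d 2 (\<lambda>y. s y $ 2 $ 1)) x))"


section \<open>The complex of smooth sections\<close>

text \<open>The point \<open>x :: real oct^2\<close> has the coordinates \<open>x\<^sub>j\<^sup>a = x $ j $ a\<close>.\<close>

definition pd :: "2 \<Rightarrow> 8 \<Rightarrow> (real oct^2 \<Rightarrow> 'v::real_normed_vector) \<Rightarrow> real oct^2 \<Rightarrow> 'v" where
  "pd j a F x = vector_derivative (\<lambda>t::real. F (x + t *\<^sub>R axis j (axis a 1))) (at 0)"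

text \<open>
  Iterated partial derivatives of all orders are differentiable, hence continuous, on the open
  set \<open>\<Omega>\<close>.
\<close>

definition smooth :: "(real oct^2) set \<Rightarrow> (real oct^2 \<Rightarrow> 'v::real_normed_vector) \<Rightarrow> bool" where
  "smooth \<Omega> F \<longleftrightarrow> (\<forall>js. fold (\<lambda>(j, a). pd j a) js F differentiable_on \<Omega>)"

text \<open>
  Sections over \<open>\<Omega>\<close> are represented by total functions, of which only the values on \<open>\<Omega>\<close> matter.
\<close>

definition Gam :: "(real oct^2) set \<Rightarrow> 'v::real_normed_vector set \<Rightarrow> (real oct^2 \<Rightarrow> 'v) set" where
  "Gam \<Omega> V = {F. smooth \<Omega> F \<and> (\<forall>x\<in>\<Omega>. F x \<in> V)}"

definition V0 :: "real set" where "V0 = UNIV"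
definition V1 :: "(real oct^2^2) set" where "V1 = H2"
definition V2 :: "(real oct^2) set" where "V2 = UNIV"
definition V3 :: "(real oct^2) set" where "V3 = UNIV"
definition V4 :: "(real oct^2^2) set" where "V4 = H2"
definition V5 :: "real set" where "V5 = UNIV"

definition hessian_sequence_is_complex :: "(real oct^2) set \<Rightarrow> bool" where
  "hessian_sequence_is_complex \<Omega> \<longleftrightarrow>
     D0 pd \<in> Gam \<Omega> V0 \<rightarrow> Gam \<Omega> V1 \<and>
     D1 pd \<in> Gam \<Omega> V1 \<rightarrow> Gam \<Omega> V2 \<and>
     D2 pd \<in> Gam \<Omega> V2 \<rightarrow> Gam \<Omega> V3 \<and>
     D3 pd \<in> Gam \<Omega> V3 \<rightarrow> Gam \<Omega> V4 \<and>
     D4 pd \<in> Gam \<Omega> V4 \<rightarrow> Gam \<Omega> V5 \<and>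
     (\<forall>f\<in>Gam \<Omega> V0. \<forall>x\<in>\<Omega>. D1 pd (D0 pd f) x = 0) \<and>
     (\<forall>u\<in>Gam \<Omega> V1. \<forall>x\<in>\<Omega>. D2 pd (D1 pd u) x = 0) \<and>
     (\<forall>v\<in>Gam \<Omega> V2. \<forall>x\<in>\<Omega>. D3 pd (D2 pd v) x = 0) \<and>
     (\<forall>t\<in>Gam \<Omega> V3. \<forall>x\<in>\<Omega>. D4 pd (D3 pd t) x = 0)"


section \<open>Symbols\<close>

definition symb :: "real oct^2 \<Rightarrow> ('x, complex) partials" where
  "symb \<xi> j a g = (\<lambda>x. \<i> * of_real (\<xi> $ j $ a) * g x)"

text \<open>
  Multiplication by \<open>\<i> \<xi>\<^sub>j\<^sup>a\<close> acts on single values; these are the functions on the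
  one-point type \<open>unit\<close>.
\<close>

definition sigma0 :: "real oct^2 \<Rightarrow> complex \<Rightarrow> complex oct^2^2" where
  "sigma0 \<xi> f = D0 (symb \<xi>) (\<lambda>_. f) ()"

definition sigma1 :: "real oct^2 \<Rightarrow> complex oct^2^2 \<Rightarrow> complex oct^2" where
  "sigma1 \<xi> u = D1 (symb \<xi>) (\<lambda>_. u) ()"

definition sigma2 :: "real oct^2 \<Rightarrow> complex oct^2 \<Rightarrow> complex oct^2" where
  "sigma2 \<xi> v = D2 (symb \<xi>) (\<lambda>_. v) ()"

definition sigma3 :: "real oct^2 \<Rightarrow> complex oct^2 \<Rightarrow> complex oct^2^2" where
  "sigma3 \<xi> t = D3 (symb \<xi>) (\<lambda>_. t) ()"

definition sigma4 :: "real oct^2 \<Rightarrow> complex oct^2^2 \<Rightarrow> complex" where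
  "sigma4 \<xi> s = D4 (symb \<xi>) (\<lambda>_. s) ()"

text \<open>Exactness at \<open>V\<close> of \<open>U \<rightarrow> V \<rightarrow> W\<close>, the maps being \<open>f\<close> and \<open>g\<close>.\<close>

definition exact_at :: "('u \<Rightarrow> 'v) \<Rightarrow> 'u set \<Rightarrow> 'v set \<Rightarrow> ('v \<Rightarrow> 'w::zero) \<Rightarrow> bool" where
  "exact_at f U V g \<longleftrightarrow> f ` U = {v \<in> V. g v = 0}"

definition symbol_sequence_exact :: "real oct^2 \<Rightarrow> bool" where
  "symbol_sequence_exact \<xi> \<longleftrightarrow>
     exact_at (\<lambda>_. 0) {0::complex} UNIV (sigma0 \<xi>) \<and>
     exact_at (sigma0 \<xi>) UNIV H2 (sigma1 \<xi>) \<and>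
     exact_at (sigma1 \<xi>) H2 UNIV (sigma2 \<xi>) \<and>
     exact_at (sigma2 \<xi>) UNIV UNIV (sigma3 \<xi>) \<and>
     exact_at (sigma3 \<xi>) UNIV H2 (sigma4 \<xi>) \<and>
     exact_at (sigma4 \<xi>) H2 UNIV (\<lambda>_. 0::complex)"

end

theory Submission
  imports Defs
begin

text \<open>
  The operators use of the partial derivatives only that they are linear and commute, and so do
  the identities \<open>D\<^sub>k\<^sub>+\<^sub>1 D\<^sub>k = 0\<close>. These are proved once, in the locale \<open>commuting_partials\<close>, and
  then applied twice: to multiplication by \<open>\<i> \<xi>\<close>, which gives the symbols, and to partial
  derivatives.

  Write \<open>x\<close> and \<open>y\<close> for the two octonionic derivatives, as if they were octonions with commuting
  coordinates, and \<open>x'\<close> for the conjugate of \<open>x\<close>. Then \<open>D\<^sub>1 D\<^sub>0 = 0\<close> says that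
  \<open>(x y') y = \<bar>y\<bar>\<^sup>2 x\<close>, which is alternativity; \<open>D\<^sub>2 D\<^sub>1 = 0\<close> comes down to the middle Moufang
  identity \<open>(x y') (q' x) = (x (y' q')) x\<close>; \<open>D\<^sub>3 D\<^sub>2 = 0\<close> to the right Moufang identity
  \<open>((x y') v) y' = x (y' (v y'))\<close> and, on the diagonal, to the fact that real parts do not see the
  position of brackets; the latter also gives \<open>D\<^sub>4 D\<^sub>3 = 0\<close>. An octonionic derivative is a sum
  over the eight basis elements, so the identities are needed with the repeated variable
  polarized (\<open>sum_polarized\<close>). They are the lemmas \<open>dbar_dunbar\<close>, \<open>dmixed_rdbar\<close>, \<open>rdunbar_dmixed\<close> and
  \<open>oRe_dunbar_dmixed\<close>.

  For the exactness of the symbols let \<open>y = \<xi>\<^sub>j \<noteq> 0\<close>. Its coordinates are real, so \<open>N = \<bar>y\<bar>\<^sup>2\<close> is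
  not zero even among complex octonions, and \<open>z \<mapsto> (z y') / N\<close> inverts right multiplication by
  \<open>y\<close>. Hence preimages can be written down, entry by entry, and where only some entries are
  matched by the choice, the already known inclusion of the image in the kernel gives the others
  (\<open>symbol_exact_index\<close>).

  Partial derivatives commute only on smooth functions and only at points of \<open>\<Omega>\<close>. To get rid of
  these side conditions, a smooth function is replaced by its jet at a point of \<open>\<Omega>\<close>, the function
  that sends a multiset of indices to the corresponding iterated partial derivative there; this is
  independent of the order by the symmetry of second derivatives. Differentiation becomes the
  shift by an index, \<open>M \<mapsto> M + {#(j, a)#}\<close>, and shifts are linear and commute on all functions of
  multisets. The jet of \<open>D\<^sub>k F\<close> is \<open>D\<^sub>k\<close>, formed
  with shifts, of the jet of \<open>F\<close>, and its value at the empty multiset is the value of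
  \<open>D\<^sub>k F\<close> at the point.
\<close>

section \<open>Coordinates of octonions over a commutative ring\<close>

lemma exhaust_8: fixes x :: 8
  shows "x = 0 \<or> x = 1 \<or> x = 2 \<or> x = 3 \<or> x = 4 \<or> x = 5 \<or> x = 6 \<or> x = 7"
proof (induct x)
  case (of_int z)
  then have "z = 0 \<or> z = 1 \<or> z = 2 \<or> z = 3 \<or> z = 4 \<or> z = 5 \<or> z = 6 \<or> z = 7" by (simp, arith)
  then show ?case by auto
qed

lemma forall_8: "(\<forall>i::8. P i) \<longleftrightarrow> P 0 \<and> P 1 \<and> P 2 \<and> P 3 \<and> P 4 \<and> P 5 \<and> P 6 \<and> P 7"
  by (metis exhaust_8)

lemma UNIV_8: "UNIV = {0, 1, 2, 3, 4, 5, 6, 7::8}"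
  using exhaust_8 by auto

lemma sum_8: "sum f (UNIV::8 set) = f 0 + f 1 + f 2 + f 3 + f 4 + f 5 + f 6 + f 7"
  unfolding UNIV_8 by (simp add: add.assoc)

lemma oct_eq_iff: "(x::'a oct) = y \<longleftrightarrow>
   x$0 = y$0 \<and> x$1 = y$1 \<and> x$2 = y$2 \<and> x$3 = y$3 \<and> x$4 = y$4 \<and> x$5 = y$5 \<and> x$6 = y$6 \<and> x$7 = y$7"
  unfolding vec_eq_iff forall_8 ..

lemma oe_nth: "(oe a :: 'a::zero_neq_one oct) $ b = (if a = b then 1 else 0)"
  by (auto simp: oe_def axis_def)

text \<open>
  The multiplication table. Identities with up to three factors are checked by expanding it; those
  with four are derived from alternativity, where expansion would be unwieldy.
\<close>

lemma omult_nth: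
  fixes x y :: "'a::comm_ring_1 oct"
  shows "(x \<odot> y) $ 0 = x$0*y$0 - x$1*y$1 - x$2*y$2 - x$3*y$3 - x$4*y$4 - x$5*y$5 - x$6*y$6 - x$7*y$7"
    "(x \<odot> y) $ 1 = x$0*y$1 + x$1*y$0 + x$2*y$3 - x$3*y$2 + x$4*y$5 - x$5*y$4 - x$6*y$7 + x$7*y$6"
    "(x \<odot> y) $ 2 = x$0*y$2 - x$1*y$3 + x$2*y$0 + x$3*y$1 + x$4*y$6 + x$5*y$7 - x$6*y$4 - x$7*y$5"
    "(x \<odot> y) $ 3 = x$0*y$3 + x$1*y$2 - x$2*y$1 + x$3*y$0 + x$4*y$7 - x$5*y$6 + x$6*y$5 - x$7*y$4"
    "(x \<odot> y) $ 4 = x$0*y$4 - x$1*y$5 - x$2*y$6 - x$3*y$7 + x$4*y$0 + x$5*y$1 + x$6*y$2 + x$7*y$3"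
    "(x \<odot> y) $ 5 = x$0*y$5 + x$1*y$4 - x$2*y$7 + x$3*y$6 - x$4*y$1 + x$5*y$0 - x$6*y$3 + x$7*y$2"
    "(x \<odot> y) $ 6 = x$0*y$6 + x$1*y$7 + x$2*y$4 - x$3*y$5 - x$4*y$2 + x$5*y$3 + x$6*y$0 - x$7*y$1"
    "(x \<odot> y) $ 7 = x$0*y$7 - x$1*y$6 + x$2*y$5 + x$3*y$4 - x$4*y$3 - x$5*y$2 + x$6*y$1 + x$7*y$0"
  by (simp_all add: omult_def opair_def olow_def ohigh_def oe_nth times_quat_def plus_quat_def
     minus_quat_def qcnj_def algebra_simps)

lemma ocnj_nth:
  fixes x :: "'a::comm_ring_1 oct"
  shows "ocnj x $ 0 = x$0" "a \<noteq> 0 \<Longrightarrow> ocnj x $ a = - x$a"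
  by (simp_all add: ocnj_def)

lemma oIm_nth:
  fixes x :: "'a::comm_ring_1 oct"
  shows "oIm x $ 0 = 0" "a \<noteq> 0 \<Longrightarrow> oIm x $ a = x$a"
  by (simp_all add: oIm_def)

lemma oscalar_nth: "(oscalar c :: 'a::comm_ring_1 oct) $ 0 = c" "a \<noteq> 0 \<Longrightarrow> oscalar c $ a = (0::'a)"
  by (simp_all add: oscalar_def axis_def)

lemmas oct_nth = omult_nth ocnj_nth oIm_nth oscalar_nth oRe_def

text \<open>
  The bilinear, not the Hermitian, norm form: over the complex numbers it has isotropic vectors,
  which is why invertibility below is always that of an octonion with real coordinates.
\<close>

definition onorm2 :: "'a::comm_ring_1 oct \<Rightarrow> 'a" where
  "onorm2 x = (\<Sum>a\<in>UNIV. x$a * x$a)"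

lemma omult_alt_left: "x \<odot> (x \<odot> y) = (x \<odot> x) \<odot> (y::'a::comm_ring_1 oct)"
  by (simp add: oct_eq_iff omult_nth algebra_simps)

lemma omult_cnj_left: "x \<odot> (ocnj x \<odot> y) = onorm2 x *s (y::'a::comm_ring_1 oct)"
  by (simp add: oct_eq_iff oct_nth onorm2_def sum_8 algebra_simps)

lemma ocnj_omult: "ocnj (x \<odot> y) = ocnj y \<odot> ocnj (x::'a::comm_ring_1 oct)"
  by (simp add: oct_eq_iff oct_nth algebra_simps)

lemma oRe_assoc: "oRe ((x \<odot> y) \<odot> z) = oRe (x \<odot> (y \<odot> (z::'a::comm_ring_1 oct)))"
  by (simp add: oct_eq_iff oct_nth algebra_simps)

lemma ocnj_ocnj [simp]: "ocnj (ocnj x) = (x::'a::comm_ring_1 oct)"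
  by (simp add: oct_eq_iff oct_nth)

lemma ocnj_add: "ocnj (x + y) = ocnj x + ocnj (y::'a::comm_ring_1 oct)"
  and ocnj_scale: "ocnj (c *s x) = c *s ocnj x"
  by (simp_all add: oct_eq_iff oct_nth)

lemma oIm_add: "oIm (x + y) = oIm x + oIm (y::'a::comm_ring_1 oct)"
  and oIm_scale: "oIm (c *s x) = c *s oIm x"
  by (simp_all add: oct_eq_iff oct_nth)

lemma omult_add_left: "(x + y) \<odot> z = x \<odot> z + y \<odot> (z::'a::comm_ring_1 oct)"
  and omult_add_right: "z \<odot> (x + y) = z \<odot> x + z \<odot> y"
  and omult_scale_left: "(c *s x) \<odot> z = c *s (x \<odot> z)"
  and omult_scale_right: "z \<odot> (c *s x) = c *s (z \<odot> x)"
  by (simp_all add: oct_eq_iff omult_nth algebra_simps)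

lemma additive_omult_left: "Modules.additive (\<lambda>x. x \<odot> (z::'a::comm_ring_1 oct))"
  and additive_omult_right: "Modules.additive (\<lambda>x. z \<odot> x)"
  by (simp_all add: Modules.additive_def omult_add_left omult_add_right)

lemmas omult_minus_left = Modules.additive.minus [OF additive_omult_left]
  and omult_minus_right = Modules.additive.minus [OF additive_omult_right]
  and omult_diff_left = Modules.additive.diff [OF additive_omult_left]
  and omult_diff_right = Modules.additive.diff [OF additive_omult_right]
  and omult_sum_left = Modules.additive.sum [OF additive_omult_left]
  and omult_sum_right = Modules.additive.sum [OF additive_omult_right]
  and omult_zero_left = Modules.additive.zero [OF additive_omult_left]
  and omult_zero_right = Modules.additive.zero [OF additive_omult_right]

lemma additive_ocnj: "Modules.additive (ocnj :: 'a::comm_ring_1 oct \<Rightarrow> _)"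
  by (simp add: Modules.additive_def ocnj_add)

lemmas ocnj_minus = Modules.additive.minus [OF additive_ocnj]
  and ocnj_diff = Modules.additive.diff [OF additive_ocnj]
  and ocnj_sum = Modules.additive.sum [OF additive_ocnj]
  and ocnj_zero = Modules.additive.zero [OF additive_ocnj]

lemma onorm2_ocnj: "onorm2 (ocnj x) = onorm2 (x::'a::comm_ring_1 oct)"
  by (simp add: onorm2_def sum_8 ocnj_nth)

lemma omult_cnj_left': "ocnj x \<odot> (x \<odot> y) = onorm2 x *s (y::'a::comm_ring_1 oct)"
  using omult_cnj_left[of "ocnj x" y] by (simp add: onorm2_ocnj)

lemma omult_cnj_right: "(y \<odot> x) \<odot> ocnj x = onorm2 x *s (y::'a::comm_ring_1 oct)"
  using arg_cong[OF omult_cnj_left[of x "ocnj y"], of ocnj] by (simp add: ocnj_omult ocnj_scale)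

lemma omult_cnj_right': "(y \<odot> ocnj x) \<odot> x = onorm2 x *s (y::'a::comm_ring_1 oct)"
  using omult_cnj_right[of y "ocnj x"] by (simp add: onorm2_ocnj)

lemma omult_alt_right: "(y \<odot> x) \<odot> x = y \<odot> (x \<odot> (x::'a::comm_ring_1 oct))"
  using arg_cong[OF omult_alt_left[of "ocnj x" "ocnj y"], of ocnj] by (simp add: ocnj_omult)

section \<open>Alternativity and the Moufang identities\<close>

definition oassoc :: "'a::comm_ring_1 oct \<Rightarrow> 'a oct \<Rightarrow> 'a oct \<Rightarrow> 'a oct" where
  "oassoc x y z = (x \<odot> y) \<odot> z - x \<odot> (y \<odot> z)"

text \<open>
  Holds in every nonassociative ring, since each product of four factors occurs twice with
  opposite signs.
\<close>

lemma oassoc_teichmueller: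
  "oassoc (a \<odot> b) c e - oassoc a (b \<odot> c) e + oassoc a b (c \<odot> e)
     = a \<odot> oassoc b c e + oassoc a b c \<odot> e"
  by (simp add: oassoc_def omult_diff_left omult_diff_right)

lemma oassoc_add:
  "oassoc (x + x') y z = oassoc x y z + oassoc x' y z"
  "oassoc x (y + y') z = oassoc x y z + oassoc x y' z"
  "oassoc x y (z + z') = oassoc x y z + oassoc x y z'"
  by (simp_all add: oassoc_def omult_add_left omult_add_right)

lemma oassoc_self: "oassoc x x y = 0" "oassoc y x x = 0"
  by (simp_all add: oassoc_def omult_alt_left omult_alt_right)

lemma oassoc_swap12: "oassoc x y z = - oassoc y x z"
proof -
  have "oassoc x y z + oassoc y x z = 0"
    using oassoc_self(1)[of "x + y" z] unfolding oassoc_add by (simp add: oassoc_self add.commute)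
  then show ?thesis by (simp only: eq_neg_iff_add_eq_0)
qed

lemma oassoc_swap23: "oassoc x y z = - oassoc x z y"
proof -
  have "oassoc x y z + oassoc x z y = 0"
    using oassoc_self(2)[of x "y + z"] unfolding oassoc_add by (simp add: oassoc_self add.commute)
  then show ?thesis by (simp only: eq_neg_iff_add_eq_0)
qed

lemma oassoc_rotate: "oassoc x y z = oassoc y z x"
  by (simp add: oassoc_swap23[of y z x] oassoc_swap12[of y x z])

text \<open>
  Inserting repeated factors into the identity above makes most associators vanish. Three such
  insertions express \<open>oassoc (x \<odot> x) y z\<close> in three ways, and comparison gives both claims. They
  carry the whole content of the Moufang identities.
\<close>

lemma oassoc_absorb_right: "oassoc x (x \<odot> y) z = oassoc x y z \<odot> x"
  and oassoc_absorb_left: "oassoc x (y \<odot> x) z = x \<odot> oassoc x y z"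
proof -
  have 1: "oassoc (x \<odot> x) y z = oassoc x (x \<odot> y) z + x \<odot> oassoc x y z" for y z
    using oassoc_teichmueller[of x x y z]
    by (simp add: oassoc_self omult_zero_left diff_eq_eq add.commute)
  have 2: "oassoc (x \<odot> x) y z = oassoc x y (z \<odot> x) + oassoc x y z \<odot> x" for y z
  proof -
    have "oassoc y z (x \<odot> x) = oassoc y (z \<odot> x) x + oassoc y z x \<odot> x"
      using oassoc_teichmueller[of y z x x]
      by (simp add: oassoc_self omult_zero_right diff_eq_eq add.commute neg_eq_iff_add_eq_0 algebra_simps)
    then show ?thesis
      by (simp only: oassoc_rotate[of x y z] oassoc_rotate[of x y "z \<odot> x"] oassoc_rotate[of "x \<odot> x" y z])
  qed
  have 3: "oassoc (x \<odot> x) z y = oassoc x (z \<odot> x) y + oassoc x z (x \<odot> y)" for y z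
  proof -
    have "oassoc (z \<odot> x) x y - oassoc z (x \<odot> x) y + oassoc z x (x \<odot> y) = 0"
      using oassoc_teichmueller[of z x x y] by (simp add: oassoc_self omult_zero_left omult_zero_right)
    then show ?thesis
      by (simp add: oassoc_swap12[of z] oassoc_swap12[of "z \<odot> x" x] algebra_simps)
  qed
  have 4: "oassoc x z (x \<odot> y) = oassoc x z y \<odot> x" for y z
  proof -
    have "oassoc (x \<odot> x) z y = oassoc x (z \<odot> x) y + oassoc x z y \<odot> x"
    proof -
      have "- oassoc (x \<odot> x) z y = - (oassoc x (z \<odot> x) y + oassoc x z y \<odot> x)"
        using 2[of y z]
        unfolding oassoc_swap23[of _ y z] oassoc_swap23[of x y "z \<odot> x"] omult_minus_left by simp
      then show ?thesis by (simp only: neg_equal_iff_equal)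
    qed
    then show ?thesis using 3[of z y] by simp
  qed
  show 5: "oassoc x (x \<odot> y) z = oassoc x y z \<odot> x"
    using 4[of z y] unfolding oassoc_swap23[of x z] by (simp add: omult_minus_left)
  show "oassoc x (y \<odot> x) z = x \<odot> oassoc x y z"
    using 1[of y z] 3[of y z] 4[of y z] 5 by simp
qed

lemma moufang_middle: "(x \<odot> y) \<odot> (z \<odot> x) = (x \<odot> (y \<odot> z)) \<odot> x"
proof -
  have "oassoc (x \<odot> y) z x = oassoc x y z \<odot> x"
    by (simp only: oassoc_absorb_right[symmetric] oassoc_rotate[of x "x \<odot> y" z])
  then show ?thesis by (simp add: oassoc_def omult_diff_left)
qed

lemma moufang_right: "((x \<odot> y) \<odot> z) \<odot> y = x \<odot> (y \<odot> (z \<odot> y))"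
proof -
  have "oassoc (x \<odot> y) z y = y \<odot> oassoc y x z"
    by (simp only: oassoc_absorb_left[symmetric] oassoc_rotate[of y "x \<odot> y" z])
  moreover have "oassoc x y (z \<odot> y) = y \<odot> oassoc y z x"
    by (simp only: oassoc_absorb_left[symmetric] oassoc_rotate[of x y "z \<odot> y"])
  ultimately have "oassoc (x \<odot> y) z y + oassoc x y (z \<odot> y) = 0"
    by (simp add: oassoc_swap23[of y x z] omult_minus_right)
  then show ?thesis by (simp add: oassoc_def)
qed

text \<open>
  The linearizations in the repeated variable, which is the form in which the identities apply to
  sums over basis elements.
\<close>

lemma moufang_middle_polarized:
  "(x \<odot> y) \<odot> (z \<odot> w) + (w \<odot> y) \<odot> (z \<odot> x) = (x \<odot> (y \<odot> z)) \<odot> w + (w \<odot> (y \<odot> z)) \<odot> x"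
  using moufang_middle[of "x + w" y z] moufang_middle[of x y z] moufang_middle[of w y z]
  by (simp add: omult_add_left omult_add_right add.commute)

lemma moufang_right_polarized:
  "((x \<odot> y) \<odot> z) \<odot> w + ((x \<odot> w) \<odot> z) \<odot> y = x \<odot> (y \<odot> (z \<odot> w)) + x \<odot> (w \<odot> (z \<odot> y))"
  using moufang_right[of x "y + w" z] moufang_right[of x y z] moufang_right[of x w z]
  by (simp add: omult_add_left omult_add_right add.commute)

lemma onorm2_add: "onorm2 (x + y) = onorm2 x + onorm2 y + 2 * (\<Sum>a\<in>UNIV. x$a * y$a)"
  by (simp add: onorm2_def algebra_simps sum.distrib mult.commute sum_distrib_left)

lemma omult_cnj_left_polarized:
  "x \<odot> (ocnj y \<odot> z) + y \<odot> (ocnj x \<odot> z) = (2 * (\<Sum>a\<in>UNIV. x$a * y$a)) *s (z::'a::comm_ring_1 oct)"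
  using omult_cnj_left[of "x+y" z] omult_cnj_left[of x z] omult_cnj_left[of y z]
  by (simp add: omult_add_left omult_add_right ocnj_add onorm2_add vector_sadd_rdistrib add.commute)

text \<open>
  The Clifford relations of the basis elements. The right-hand sides are kept as two conditionals
  so that they match \<open>sum_polarized\<close>.
\<close>

lemma oe_cnj_polarized:
  fixes z :: "'a::comm_ring_1 oct"
  shows "oe a \<odot> (ocnj (oe b) \<odot> z) + oe b \<odot> (ocnj (oe a) \<odot> z)
      = (if a = b then z else 0) + (if b = a then z else 0)"
    and "ocnj (oe a) \<odot> (oe b \<odot> z) + ocnj (oe b) \<odot> (oe a \<odot> z)
      = (if a = b then z else 0) + (if b = a then z else 0)"
proof -
  have orth: "(\<Sum>i\<in>UNIV. oe a $ i * oe b $ i) = (if a = b then 1 else (0::'a))"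
    by (simp add: oe_nth if_distrib[of "\<lambda>x. x * _"] cong: if_cong)
  have "ocnj (oe a) $ i * ocnj (oe b) $ i = oe a $ i * (oe b $ i :: 'a)" for i
    by (simp add: ocnj_def)
  then have orth': "(\<Sum>i\<in>UNIV. ocnj (oe a) $ i * ocnj (oe b) $ i) = (if a = b then 1 else (0::'a))"
    using orth by simp
  show "oe a \<odot> (ocnj (oe b) \<odot> z) + oe b \<odot> (ocnj (oe a) \<odot> z)
      = (if a = b then z else 0) + (if b = a then z else 0)"
    using omult_cnj_left_polarized[of "oe a" "oe b" z] orth by (auto simp: oct_eq_iff)
  show "ocnj (oe a) \<odot> (oe b \<odot> z) + ocnj (oe b) \<odot> (oe a \<odot> z)
      = (if a = b then z else 0) + (if b = a then z else 0)"
    using omult_cnj_left_polarized[of "ocnj (oe a)" "ocnj (oe b)" z] orth' by (auto simp: oct_eq_iff)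
qed

lemma oRe_ocnj [simp]: "oRe (ocnj x) = oRe (x::'a::comm_ring_1 oct)"
  by (simp add: oct_nth)

lemma oRe_commute: "oRe (x \<odot> y) = oRe (y \<odot> (x::'a::comm_ring_1 oct))"
  by (simp add: oct_nth algebra_simps)

lemma omult_oscalar: "oscalar c \<odot> x = c *s x" "x \<odot> oscalar c = c *s (x::'a::comm_ring_1 oct)"
  by (simp_all add: oct_eq_iff oct_nth algebra_simps)

section \<open>Operators built from commuting linear derivatives\<close>

lemma olinear_expand:
  fixes L :: "'a::comm_ring_1 oct \<Rightarrow> 'a oct"
  assumes "Modules.additive L" "\<And>c v. L (c *s v) = c *s L v"
  shows "L v = (\<Sum>b\<in>UNIV. v$b *s L (oe b))"
proof -
  have "v = (\<Sum>b\<in>UNIV. v$b *s oe b)"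
    by (simp add: oct_eq_iff sum_8 oe_nth)
  then have "L v = L (\<Sum>b\<in>UNIV. v$b *s oe b)" by simp
  then show ?thesis by (simp add: Modules.additive.sum[OF assms(1)] assms(2))
qed

text \<open>
  An identity that holds after symmetrization in two indices may be used under a double sum. Applied
  with terms in which \<open>a\<close> and \<open>b\<close> index commuting derivatives in the same variable.
\<close>

lemma sum_polarized:
  fixes P Q :: "'b::finite \<Rightarrow> 'b \<Rightarrow> 'v::real_vector"
  assumes "\<And>a b. P a b + P b a = Q a b + Q b a"
  shows "(\<Sum>a\<in>UNIV. \<Sum>b\<in>UNIV. P a b) = (\<Sum>a\<in>UNIV. \<Sum>b\<in>UNIV. Q a b)"
proof -
  have double: "2 *\<^sub>R (\<Sum>a\<in>UNIV. \<Sum>b\<in>UNIV. R a b) = (\<Sum>a\<in>UNIV. \<Sum>b\<in>UNIV. R a b + R b a)"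
    for R :: "'b \<Rightarrow> 'b \<Rightarrow> 'v"
    using sum.swap[of "\<lambda>a b. R b a" UNIV UNIV] by (simp add: sum.distrib scaleR_2)
  have "2 *\<^sub>R (\<Sum>a\<in>UNIV. \<Sum>b\<in>UNIV. P a b) = 2 *\<^sub>R (\<Sum>a\<in>UNIV. \<Sum>b\<in>UNIV. Q a b)"
    unfolding double by (simp add: assms)
  then show ?thesis by simp
qed

definition vlaplace :: "('x, 'a::comm_ring_1) partials \<Rightarrow> 2 \<Rightarrow> ('x \<Rightarrow> 'a oct) \<Rightarrow> 'x \<Rightarrow> 'a oct" where
  "vlaplace d j F = (\<lambda>x. \<Sum>a\<in>UNIV. odiff d j a (odiff d j a F) x)"

text \<open>
  The functions are total and there is no condition of smoothness, so that the laws can be used as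
  unconditional rewrite rules below binders.
\<close>

locale commuting_partials =
  fixes d :: "('x, 'a::real_normed_field) partials"
  assumes d_add: "d j a (\<lambda>x. f x + g x) = (\<lambda>x. d j a f x + d j a g x)"
    and d_scale: "d j a (\<lambda>x. c * f x) = (\<lambda>x. c * d j a f x)"
    and d_commute: "d j a (d k b f) = d k b (d j a f)"
begin

lemma d_zero: "d j a (\<lambda>x. 0) = (\<lambda>x. 0)"
  using d_scale[of j a 0] by simp

lemma d_sum: "d j a (\<lambda>x. \<Sum>b\<in>B. f b x) = (\<lambda>x. \<Sum>b\<in>B. d j a (f b) x)"
proof (induction B rule: infinite_finite_induct)
  case (insert b B) then show ?case by (simp add: d_add)
qed (simp_all add: d_zero)

lemma odiff_commute: "odiff d j a (odiff d k b F) = odiff d k b (odiff d j a F)"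
  using d_commute by (auto simp: odiff_def fun_eq_iff vec_eq_iff)

lemma odiff_add: "odiff d j a (\<lambda>x. F x + G x) = (\<lambda>x. odiff d j a F x + odiff d j a G x)"
  by (simp add: odiff_def fun_eq_iff vec_eq_iff d_add)

lemma odiff_linear:
  assumes "Modules.additive L" "\<And>c v. L (c *s v) = c *s L v"
  shows "odiff d j a (\<lambda>x. L (F x)) = (\<lambda>x. L (odiff d j a F x))"
proof -
  have "d j a (\<lambda>y. L (F y) $ k) x = L (odiff d j a F x) $ k" for k x
  proof -
    have 1: "L v $ k = (\<Sum>b\<in>UNIV. L (oe b) $ k * v$b)" for v
      using arg_cong[OF olinear_expand[OF assms, of v], of "\<lambda>w. w $ k"]
      by (simp add: mult.commute)
    have "(\<lambda>y. L (F y) $ k) = (\<lambda>y. \<Sum>b\<in>UNIV. L (oe b) $ k * F y $ b)"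
      by (rule ext) (rule 1)
    then have "d j a (\<lambda>y. L (F y) $ k) x = (\<Sum>b\<in>UNIV. L (oe b) $ k * odiff d j a F x $ b)"
      by (simp add: d_sum d_scale odiff_def)
    also have "\<dots> = L (odiff d j a F x) $ k" by (rule 1[symmetric])
    finally show ?thesis .
  qed
  then show ?thesis by (simp add: odiff_def[of _ _ _ "\<lambda>x. L (F x)"] fun_eq_iff vec_eq_iff)
qed

lemma odiff_omult_left: "odiff d j a (\<lambda>x. c \<odot> F x) = (\<lambda>x. c \<odot> odiff d j a F x)"
  by (rule odiff_linear) (simp_all add: Modules.additive_def omult_add_right omult_scale_right)

lemma odiff_omult_right: "odiff d j a (\<lambda>x. F x \<odot> c) = (\<lambda>x. odiff d j a F x \<odot> c)"
  by (rule odiff_linear) (simp_all add: Modules.additive_def omult_add_left omult_scale_left)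

lemma odiff_ocnj: "odiff d j a (\<lambda>x. ocnj (F x)) = (\<lambda>x. ocnj (odiff d j a F x))"
  by (rule odiff_linear) (simp_all add: additive_ocnj ocnj_scale)

lemma odiff_minus: "odiff d j a (\<lambda>x. - F x) = (\<lambda>x. - odiff d j a F x)"
  by (rule odiff_linear) (simp_all add: Modules.additive_def)

lemma odiff_diff: "odiff d j a (\<lambda>x. F x - G x) = (\<lambda>x. odiff d j a F x - odiff d j a G x)"
  using odiff_add[of j a F "\<lambda>x. - G x"] by (simp add: odiff_minus)

lemma odiff_zero: "odiff d j a (\<lambda>x. 0) = (\<lambda>x. 0)"
  by (simp add: odiff_def d_zero fun_eq_iff vec_eq_iff)

lemma odiff_sum: "odiff d j a (\<lambda>x. \<Sum>b\<in>B. F b x) = (\<lambda>x. \<Sum>b\<in>B. odiff d j a (F b) x)"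
proof (induction B rule: infinite_finite_induct)
  case (insert b B) then show ?case by (simp add: odiff_add)
qed (simp_all add: odiff_zero)

lemma odiff_oscalar: "odiff d j a (\<lambda>x. oscalar (f x)) = (\<lambda>x. oscalar (d j a f x))"
proof -
  have "d j a (\<lambda>y. oscalar (f y) $ b) x = oscalar (d j a f x) $ b" for b x
    by (cases "b = 0") (simp_all add: oscalar_nth d_zero)
  then show ?thesis by (simp add: odiff_def fun_eq_iff vec_eq_iff)
qed

lemma odiff_scale: "odiff d j a (\<lambda>x. f x *s c) = (\<lambda>x. d j a f x *s c)"
  using odiff_omult_right[of j a "\<lambda>x. oscalar (f x)" c] by (simp add: odiff_oscalar omult_oscalar)

lemmas odiff_simps = odiff_scale odiff_add odiff_diff odiff_minus odiff_sum odiff_ocnj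
  odiff_omult_left odiff_omult_right

lemma odiff_dbar: "odiff d k b (dbar d j F) = dbar d j (odiff d k b F)"
  and odiff_dunbar: "odiff d k b (dunbar d j F) = dunbar d j (odiff d k b F)"
  and odiff_rdbar: "odiff d k b (rdbar d j F) = rdbar d j (odiff d k b F)"
  and odiff_rdunbar: "odiff d k b (rdunbar d j F) = rdunbar d j (odiff d k b F)"
  by (simp_all add: dbar_def dunbar_def rdbar_def rdunbar_def odiff_simps odiff_commute[of k b])

lemma dbar_diff: "dbar d j (\<lambda>x. F x - G x) = (\<lambda>x. dbar d j F x - dbar d j G x)"
  and dunbar_diff: "dunbar d j (\<lambda>x. F x - G x) = (\<lambda>x. dunbar d j F x - dunbar d j G x)"
  and rdbar_diff: "rdbar d j (\<lambda>x. F x - G x) = (\<lambda>x. rdbar d j F x - rdbar d j G x)"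
  and rdunbar_diff: "rdunbar d j (\<lambda>x. F x - G x) = (\<lambda>x. rdunbar d j F x - rdunbar d j G x)"
  and dmixed_diff: "dmixed d i j (\<lambda>x. F x - G x) = (\<lambda>x. dmixed d i j F x - dmixed d i j G x)"
  and vlaplace_diff: "vlaplace d j (\<lambda>x. F x - G x) = (\<lambda>x. vlaplace d j F x - vlaplace d j G x)"
  by (simp_all add: dbar_def dunbar_def rdbar_def rdunbar_def dmixed_def vlaplace_def odiff_diff
      omult_diff_left omult_diff_right sum_subtractf)

lemma dbar_add: "dbar d j (\<lambda>x. F x + G x) = (\<lambda>x. dbar d j F x + dbar d j G x)"
  and dunbar_add: "dunbar d j (\<lambda>x. F x + G x) = (\<lambda>x. dunbar d j F x + dunbar d j G x)"
  and rdbar_add: "rdbar d j (\<lambda>x. F x + G x) = (\<lambda>x. rdbar d j F x + rdbar d j G x)"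
  and rdunbar_add: "rdunbar d j (\<lambda>x. F x + G x) = (\<lambda>x. rdunbar d j F x + rdunbar d j G x)"
  and dmixed_add: "dmixed d i j (\<lambda>x. F x + G x) = (\<lambda>x. dmixed d i j F x + dmixed d i j G x)"
  and vlaplace_add: "vlaplace d j (\<lambda>x. F x + G x) = (\<lambda>x. vlaplace d j F x + vlaplace d j G x)"
  by (simp_all add: dbar_def dunbar_def rdbar_def rdunbar_def dmixed_def vlaplace_def odiff_add
      omult_add_left omult_add_right sum.distrib)

lemmas op_linear = dbar_diff dunbar_diff rdbar_diff rdunbar_diff dmixed_diff vlaplace_diff
  dbar_add dunbar_add rdbar_add rdunbar_add dmixed_add vlaplace_add

text \<open>
  Conjugation exchanges left and right, and barred and unbarred. Each statement about operators from
  the left thus has a mirror image, which is obtained in this way and not by a second computation.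
\<close>

lemma ocnj_dbar: "ocnj (dbar d j F x) = rdunbar d j (\<lambda>y. ocnj (F y)) x"
  and ocnj_dunbar: "ocnj (dunbar d j F x) = rdbar d j (\<lambda>y. ocnj (F y)) x"
  and ocnj_rdbar: "ocnj (rdbar d j F x) = dunbar d j (\<lambda>y. ocnj (F y)) x"
  and ocnj_rdunbar: "ocnj (rdunbar d j F x) = dbar d j (\<lambda>y. ocnj (F y)) x"
  by (simp_all add: dbar_def dunbar_def rdbar_def rdunbar_def odiff_ocnj ocnj_sum ocnj_omult)

lemma ocnj_vlaplace: "ocnj (vlaplace d j F x) = vlaplace d j (\<lambda>y. ocnj (F y)) x"
  by (simp add: vlaplace_def odiff_ocnj ocnj_sum)

lemmas ocnj_op = ocnj_dbar ocnj_dunbar ocnj_rdbar ocnj_rdunbar ocnj_vlaplace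

text \<open>
  Alternativity \<open>x (x' v) = \<bar>x\<bar>\<^sup>2 v\<close>: the terms with \<open>a \<noteq> b\<close> cancel in pairs because the
  derivatives commute.
\<close>

lemma dbar_dunbar: "dbar d j (dunbar d j F) = vlaplace d j F"
proof
  fix x
  let ?W = "\<lambda>a b. odiff d j a (odiff d j b F) x"
  have "dbar d j (dunbar d j F) x = (\<Sum>a\<in>UNIV. \<Sum>b\<in>UNIV. oe a \<odot> (ocnj (oe b) \<odot> ?W a b))"
    by (simp add: dbar_def dunbar_def odiff_simps omult_sum_right)
  also have "\<dots> = (\<Sum>a\<in>UNIV. \<Sum>b\<in>UNIV. if a = b then ?W a b else 0)"
  proof (rule sum_polarized)
    fix a b :: 8
    show "oe a \<odot> (ocnj (oe b) \<odot> ?W a b) + oe b \<odot> (ocnj (oe a) \<odot> ?W b a)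
        = (if a = b then ?W a b else 0) + (if b = a then ?W b a else 0)"
      using oe_cnj_polarized(1)[of a b "?W a b"] odiff_commute[of j a j b F] by simp
  qed
  also have "\<dots> = vlaplace d j F x" by (simp add: vlaplace_def)
  finally show "dbar d j (dunbar d j F) x = vlaplace d j F x" .
qed

lemma dunbar_dbar: "dunbar d j (dbar d j F) = vlaplace d j F"
proof
  fix x
  let ?W = "\<lambda>a b. odiff d j a (odiff d j b F) x"
  have "dunbar d j (dbar d j F) x = (\<Sum>a\<in>UNIV. \<Sum>b\<in>UNIV. ocnj (oe a) \<odot> (oe b \<odot> ?W a b))"
    by (simp add: dbar_def dunbar_def odiff_simps omult_sum_right)
  also have "\<dots> = (\<Sum>a\<in>UNIV. \<Sum>b\<in>UNIV. if a = b then ?W a b else 0)"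
  proof (rule sum_polarized)
    fix a b :: 8
    show "ocnj (oe a) \<odot> (oe b \<odot> ?W a b) + ocnj (oe b) \<odot> (oe a \<odot> ?W b a)
        = (if a = b then ?W a b else 0) + (if b = a then ?W b a else 0)"
      using oe_cnj_polarized(2)[of a b "?W a b"] odiff_commute[of j a j b F] by simp
  qed
  also have "\<dots> = vlaplace d j F x" by (simp add: vlaplace_def)
  finally show "dunbar d j (dbar d j F) x = vlaplace d j F x" .
qed

lemma rdbar_rdunbar: "rdbar d j (rdunbar d j F) = vlaplace d j F"
  and rdunbar_rdbar: "rdunbar d j (rdbar d j F) = vlaplace d j F"
proof -
  show "rdbar d j (rdunbar d j F) = vlaplace d j F"
    using dunbar_dbar[of j "\<lambda>y. ocnj (F y)", THEN fun_cong, THEN arg_cong[of _ _ ocnj]]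
    by (simp add: ocnj_op fun_eq_iff)
  show "rdunbar d j (rdbar d j F) = vlaplace d j F"
    using dbar_dunbar[of j "\<lambda>y. ocnj (F y)", THEN fun_cong, THEN arg_cong[of _ _ ocnj]]
    by (simp add: ocnj_op fun_eq_iff)
qed

lemma vlaplace_dbar: "vlaplace d k (dbar d j F) = dbar d j (vlaplace d k F)"
  and vlaplace_dunbar: "vlaplace d k (dunbar d j F) = dunbar d j (vlaplace d k F)"
  and vlaplace_rdbar: "vlaplace d k (rdbar d j F) = rdbar d j (vlaplace d k F)"
  and vlaplace_rdunbar: "vlaplace d k (rdunbar d j F) = rdunbar d j (vlaplace d k F)"
  unfolding vlaplace_def odiff_dbar odiff_dunbar odiff_rdbar odiff_rdunbar
  unfolding dbar_def dunbar_def rdbar_def rdunbar_def odiff_sum omult_sum_left omult_sum_right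
  by (intro ext sum.swap)+

text \<open>
  The middle Moufang identity \<open>(x y') (v x) = (x (y' v)) x\<close> for operators, with the repeated
  derivative \<open>x\<close> polarized.
\<close>

lemma dmixed_rdbar: "dmixed d i j (rdbar d i F) = rdbar d i (dbar d i (dunbar d j F))"
proof
  fix x
  let ?W = "\<lambda>a b c. odiff d i a (odiff d j b (odiff d i c F)) x"
  have W: "?W a b c = ?W c b a" for a b c
    by (simp only: odiff_commute[of i _ j] odiff_commute[of i a i c])
  have "dmixed d i j (rdbar d i F) x
      = (\<Sum>a\<in>UNIV. \<Sum>b\<in>UNIV. \<Sum>c\<in>UNIV. (oe a \<odot> ocnj (oe b)) \<odot> (?W a b c \<odot> oe c))"
    by (simp add: dmixed_def rdbar_def odiff_simps omult_sum_right)
  also have "\<dots> = (\<Sum>a\<in>UNIV. \<Sum>c\<in>UNIV. \<Sum>b\<in>UNIV. (oe a \<odot> ocnj (oe b)) \<odot> (?W a b c \<odot> oe c))"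
    by (intro sum.cong sum.swap refl)
  also have "\<dots> = (\<Sum>a\<in>UNIV. \<Sum>c\<in>UNIV. \<Sum>b\<in>UNIV. (oe a \<odot> (ocnj (oe b) \<odot> ?W a b c)) \<odot> oe c)"
  proof (rule sum_polarized)
    fix a c :: 8
    show "(\<Sum>b\<in>UNIV. (oe a \<odot> ocnj (oe b)) \<odot> (?W a b c \<odot> oe c))
           + (\<Sum>b\<in>UNIV. (oe c \<odot> ocnj (oe b)) \<odot> (?W c b a \<odot> oe a))
        = (\<Sum>b\<in>UNIV. (oe a \<odot> (ocnj (oe b) \<odot> ?W a b c)) \<odot> oe c)
           + (\<Sum>b\<in>UNIV. (oe c \<odot> (ocnj (oe b) \<odot> ?W c b a)) \<odot> oe a)"
      by (simp add: W[of c _ a] moufang_middle_polarized flip: sum.distrib)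
  qed
  also have "\<dots> = (\<Sum>c\<in>UNIV. \<Sum>a\<in>UNIV. \<Sum>b\<in>UNIV. (oe a \<odot> (ocnj (oe b) \<odot> odiff d i c (odiff d i a (odiff d j b F)) x)) \<odot> oe c)"
  proof -
    have "?W a b c = odiff d i c (odiff d i a (odiff d j b F)) x" for a b c
      by (simp only: odiff_commute[of i _ j] odiff_commute[of i c i a])
    then show ?thesis by (subst sum.swap) simp
  qed
  also have "\<dots> = rdbar d i (dbar d i (dunbar d j F)) x"
    by (simp add: rdbar_def dbar_def dunbar_def odiff_simps omult_sum_right omult_sum_left)
  finally show "dmixed d i j (rdbar d i F) x = rdbar d i (dbar d i (dunbar d j F)) x" .
qed

text \<open>
  The right Moufang identity \<open>((x y') v) y' = x (y' (v y'))\<close> for operators, with the repeated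
  derivative \<open>y'\<close> polarized.
\<close>

lemma rdunbar_dmixed: "rdunbar d j (dmixed d i j F) = dbar d i (dunbar d j (rdunbar d j F))"
proof
  fix x
  let ?W = "\<lambda>a b c. odiff d j c (odiff d i a (odiff d j b F)) x"
  have W: "?W a b c = ?W a c b" for a b c
    by (simp only: odiff_commute[of j _ i] odiff_commute[of j c j b])
  have "rdunbar d j (dmixed d i j F) x
      = (\<Sum>c\<in>UNIV. \<Sum>a\<in>UNIV. \<Sum>b\<in>UNIV. ((oe a \<odot> ocnj (oe b)) \<odot> ?W a b c) \<odot> ocnj (oe c))"
    by (simp add: dmixed_def rdunbar_def odiff_simps omult_sum_left)
  also have "\<dots> = (\<Sum>a\<in>UNIV. \<Sum>c\<in>UNIV. \<Sum>b\<in>UNIV. ((oe a \<odot> ocnj (oe b)) \<odot> ?W a b c) \<odot> ocnj (oe c))"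
    by (rule sum.swap)
  also have "\<dots> = (\<Sum>a\<in>UNIV. \<Sum>c\<in>UNIV. \<Sum>b\<in>UNIV. oe a \<odot> (ocnj (oe b) \<odot> (?W a b c \<odot> ocnj (oe c))))"
  proof (rule sum.cong[OF refl], rule sum_polarized)
    fix a b c :: 8
    show "((oe a \<odot> ocnj (oe c)) \<odot> ?W a c b) \<odot> ocnj (oe b) + ((oe a \<odot> ocnj (oe b)) \<odot> ?W a b c) \<odot> ocnj (oe c)
      = oe a \<odot> (ocnj (oe c) \<odot> (?W a c b \<odot> ocnj (oe b))) + oe a \<odot> (ocnj (oe b) \<odot> (?W a b c \<odot> ocnj (oe c)))"
      using moufang_right_polarized[of "oe a" "ocnj (oe b)" "?W a b c" "ocnj (oe c)"] W[of b a c]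
      by (simp add: add.commute)
  qed
  also have "\<dots> = (\<Sum>a\<in>UNIV. \<Sum>b\<in>UNIV. \<Sum>c\<in>UNIV. oe a \<odot> (ocnj (oe b) \<odot> (odiff d i a (odiff d j b (odiff d j c F)) x \<odot> ocnj (oe c))))"
  proof -
    have "?W a b c = odiff d i a (odiff d j b (odiff d j c F)) x" for a b c
      by (simp only: odiff_commute[of j _ i] odiff_commute[of j c j b])
    then show ?thesis by (simp only:) (rule sum.cong[OF refl], rule sum.swap)
  qed
  also have "\<dots> = dbar d i (dunbar d j (rdunbar d j F)) x"
    by (simp add: rdunbar_def dbar_def dunbar_def odiff_simps omult_sum_right omult_sum_left)
  finally show "rdunbar d j (dmixed d i j F) x = dbar d i (dunbar d j (rdunbar d j F)) x" .
qed


lemma vlaplace_oscalar: "vlaplace d j (\<lambda>x. oscalar (f x)) = (\<lambda>x. oscalar (laplace d j f x))"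
proof -
  have "oscalar (\<Sum>a\<in>A. g a) = (\<Sum>a\<in>A. oscalar (g a) :: 'a oct)" for g and A :: "8 set"
    by (simp add: oscalar_def vec_eq_iff axis_def)
  then show ?thesis by (simp add: vlaplace_def laplace_def odiff_oscalar)
qed

text \<open>
  On scalar functions left and right operators agree and brackets with one scalar factor may be moved.
\<close>

lemma dbar_oscalar: "dbar d j (\<lambda>x. oscalar (f x)) = rdbar d j (\<lambda>x. oscalar (f x))"
  by (simp add: dbar_def rdbar_def odiff_oscalar omult_oscalar)

lemma dmixed_oscalar:
  "dmixed d i j (\<lambda>x. oscalar (f x)) = rdunbar d j (dbar d i (\<lambda>x. oscalar (f x)))"
  "dmixed d i j (\<lambda>x. oscalar (f x)) = dbar d i (rdunbar d j (\<lambda>x. oscalar (f x)))"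
  by (simp_all add: dmixed_def dbar_def rdunbar_def odiff_simps odiff_oscalar omult_oscalar
      omult_sum_left omult_sum_right omult_scale_left omult_scale_right d_commute[of j _ i] fun_eq_iff)
     (intro allI sum.swap)

lemma dmixed_dbar_oscalar:
  "dmixed d i j (dbar d j (\<lambda>x. oscalar (f x))) = vlaplace d j (dbar d i (\<lambda>x. oscalar (f x)))"
proof -
  have "dmixed d i j (dbar d j (\<lambda>x. oscalar (f x))) = rdbar d j (dmixed d i j (\<lambda>x. oscalar (f x)))"
  proof
    fix x
    have "dmixed d i j (dbar d j (\<lambda>x. oscalar (f x))) x
      = (\<Sum>a\<in>UNIV. \<Sum>b\<in>UNIV. \<Sum>c\<in>UNIV. d i a (d j b (d j c f)) x *s ((oe a \<odot> ocnj (oe b)) \<odot> oe c))"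
      by (simp add: dmixed_def dbar_def odiff_simps odiff_oscalar omult_oscalar omult_sum_right omult_scale_right)
    also have "\<dots> = (\<Sum>a\<in>UNIV. \<Sum>c\<in>UNIV. \<Sum>b\<in>UNIV. d i a (d j b (d j c f)) x *s ((oe a \<odot> ocnj (oe b)) \<odot> oe c))"
      by (intro sum.cong sum.swap refl)
    also have "\<dots> = (\<Sum>c\<in>UNIV. \<Sum>a\<in>UNIV. \<Sum>b\<in>UNIV. d i a (d j b (d j c f)) x *s ((oe a \<odot> ocnj (oe b)) \<odot> oe c))"
      by (rule sum.swap)
    also have "\<dots> = rdbar d j (dmixed d i j (\<lambda>x. oscalar (f x))) x"
    proof -
      have "d j c (d i a (d j b f)) = d i a (d j b (d j c f))" for a b c
        by (simp only: d_commute[of j _ i] d_commute[of j c j b])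
      then show ?thesis
        by (simp add: dmixed_def rdbar_def odiff_simps odiff_oscalar omult_oscalar omult_sum_left omult_scale_left)
    qed
    finally show "dmixed d i j (dbar d j (\<lambda>x. oscalar (f x))) x = rdbar d j (dmixed d i j (\<lambda>x. oscalar (f x))) x" .
  qed
  then show ?thesis by (simp add: dmixed_oscalar(1) rdbar_rdunbar)
qed

lemma oRe_sum: "oRe (\<Sum>a\<in>A. F a) = (\<Sum>a\<in>A. oRe (F a :: 'a oct))"
  by (simp add: oRe_def)

text \<open>
  Left and right operators do not commute in general; they do under the real part, because
  \<open>oRe (x (v y)) = oRe ((x v) y)\<close>.
\<close>

lemma oRe_dunbar_rdbar: "oRe (dunbar d j (rdbar d i F) x) = oRe (rdbar d i (dunbar d j F) x)"
  by (simp add: dunbar_def rdbar_def odiff_simps omult_sum_left omult_sum_right oRe_sum oRe_assoc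
      odiff_commute[of j _ i]) (rule sum.swap)

text \<open>
  Under the real part the product may be bracketed as \<open>(x' (x y')) v\<close>, and \<open>x' (x y') = \<bar>x\<bar>\<^sup>2 y'\<close>
  by alternativity.
\<close>

lemma oRe_dunbar_dmixed: "oRe (dunbar d i (dmixed d i j F) x) = oRe (dunbar d j (vlaplace d i F) x)"
proof -
  let ?W = "\<lambda>a b c. odiff d i a (odiff d i b (odiff d j c F)) x"
  have W: "?W a b c = ?W b a c" for a b c
    by (simp only: odiff_commute[of i a i b])
  have "oRe (dunbar d i (dmixed d i j F) x)
      = oRe (\<Sum>a\<in>UNIV. \<Sum>b\<in>UNIV. \<Sum>c\<in>UNIV. (ocnj (oe a) \<odot> (oe b \<odot> ocnj (oe c))) \<odot> ?W a b c)"
    by (simp add: dunbar_def dmixed_def odiff_simps omult_sum_left omult_sum_right oRe_sum oRe_assoc)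
  also have "(\<Sum>a\<in>UNIV. \<Sum>b\<in>UNIV. \<Sum>c\<in>UNIV. (ocnj (oe a) \<odot> (oe b \<odot> ocnj (oe c))) \<odot> ?W a b c)
    = (\<Sum>a\<in>UNIV. \<Sum>b\<in>UNIV. \<Sum>c\<in>UNIV. (if a = b then ocnj (oe c) else 0) \<odot> ?W a b c)"
  proof (rule sum_polarized)
    fix a b :: 8
    show "(\<Sum>c\<in>UNIV. (ocnj (oe a) \<odot> (oe b \<odot> ocnj (oe c))) \<odot> ?W a b c)
        + (\<Sum>c\<in>UNIV. (ocnj (oe b) \<odot> (oe a \<odot> ocnj (oe c))) \<odot> ?W b a c)
      = (\<Sum>c\<in>UNIV. (if a = b then ocnj (oe c) else 0) \<odot> ?W a b c)
        + (\<Sum>c\<in>UNIV. (if b = a then ocnj (oe c) else 0) \<odot> ?W b a c)"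
      by (simp add: W[of b a] oe_cnj_polarized(2) flip: sum.distrib omult_add_left)
  qed
  also have "\<dots> = dunbar d j (vlaplace d i F) x"
  proof -
    have "(\<Sum>b\<in>UNIV. \<Sum>c\<in>UNIV. (if a = b then ocnj (oe c) else 0) \<odot> ?W a b c)
        = (\<Sum>c\<in>UNIV. ocnj (oe c) \<odot> ?W a a c)" for a
    proof -
      have "(\<Sum>c\<in>UNIV. (if a = b then ocnj (oe c) else 0) \<odot> ?W a b c)
        = (if a = b then (\<Sum>c\<in>UNIV. ocnj (oe c) \<odot> ?W a a c) else 0)" for b
        by (simp add: omult_zero_left)
      then show ?thesis by simp
    qed
    moreover have "?W a a c = odiff d j c (odiff d i a (odiff d i a F)) x" for a c
      by (simp only: odiff_commute[of j _ i])
    ultimately show ?thesis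
      by (simp add: dunbar_def vlaplace_def odiff_simps omult_sum_right) (rule sum.swap)
  qed
  finally show ?thesis .
qed

end

section \<open>The compositions of consecutive operators vanish\<close>

lemma vec2_eq_iff: "(x::'a^2) = y \<longleftrightarrow> x$1 = y$1 \<and> x$2 = y$2"
  by (simp add: vec_eq_iff forall_2)

lemma oIm_double: "2 *\<^sub>R oIm x = x - ocnj (x::'a::real_normed_field oct)"
  by (simp add: oct_eq_iff oct_nth scaleR_2)

lemma oIm_eq_0_iff: "oIm x = 0 \<longleftrightarrow> x = oscalar (oRe (x::'a::comm_ring_1 oct))"
  by (simp add: oct_eq_iff oct_nth)

lemma oIm_minus: "oIm (- x) = - oIm (x::'a::comm_ring_1 oct)"
  by (simp add: oct_eq_iff oct_nth)

lemma oIm_oscalar: "oIm (oscalar c :: 'a::comm_ring_1 oct) = 0"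
  by (simp add: oct_eq_iff oct_nth)

text \<open>
  Membership as three linear equations, which are inherited by jets.
\<close>

lemma mem_H2_iff:
  "u \<in> H2 \<longleftrightarrow> oIm (u$1$1) = 0 \<and> oIm (u$2$2) = 0 \<and> u$2$1 = ocnj (u$1$2)"
proof
  assume "u \<in> H2"
  then show "oIm (u$1$1) = 0 \<and> oIm (u$2$2) = 0 \<and> u$2$1 = ocnj (u$1$2)"
    by (auto simp: H2_def oIm_oscalar)
next
  assume "oIm (u$1$1) = 0 \<and> oIm (u$2$2) = 0 \<and> u$2$1 = ocnj (u$1$2)"
  then have "u = vector [vector [oscalar (oRe (u$1$1)), u$1$2], vector [ocnj (u$1$2), oscalar (oRe (u$2$2))]]"
    by (simp add: vec2_eq_iff oIm_eq_0_iff[symmetric])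
  then show "u \<in> H2" unfolding H2_def by blast
qed

text \<open>
  The two components of \<open>D2\<close> are exchanged when the indices are swapped; with \<open>i\<close> and \<open>j\<close> as
  arguments it is enough to treat one of them.
\<close>

definition D2_entry :: "('x, 'a::real_normed_field) partials \<Rightarrow> 2 \<Rightarrow> 2 \<Rightarrow> ('x \<Rightarrow> 'a oct) \<Rightarrow> ('x \<Rightarrow> 'a oct) \<Rightarrow> 'x \<Rightarrow> 'a oct" where
  "D2_entry d i j v w = (\<lambda>x. dmixed d i j w x - rdbar d j (dbar d i (\<lambda>y. ocnj (w y))) x
     + 2 *\<^sub>R rdbar d i (\<lambda>y. oIm (rdunbar d i v y)) x)"

lemma D2_eq: "D2 d v x = vector [D2_entry d 1 2 (\<lambda>y. v y $ 1) (\<lambda>y. v y $ 2) x,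
   D2_entry d 2 1 (\<lambda>y. v y $ 2) (\<lambda>y. v y $ 1) x]"
  by (simp add: D2_def D2_entry_def)

context commuting_partials
begin

text \<open>
  Twice the imaginary part of \<open>z\<close> is \<open>z\<close> minus its conjugate, and for \<open>z = v x'\<close> the first term
  contributes \<open>(v x') x = \<bar>x\<bar>\<^sup>2 v\<close>. In this form \<open>D2\<close> is built from operators that the previous
  lemmas let commute.
\<close>

lemma D2_entry_eq: "D2_entry d i j v w = (\<lambda>x. dmixed d i j w x - rdbar d j (dbar d i (\<lambda>y. ocnj (w y))) x
    + vlaplace d i v x - rdbar d i (dbar d i (\<lambda>y. ocnj (v y))) x)"
proof
  fix x
  let ?G = "rdunbar d i v"
  have "2 *\<^sub>R rdbar d i (\<lambda>y. oIm (?G y)) x = rdbar d i (\<lambda>y. 2 *\<^sub>R oIm (?G y)) x"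
    by (simp only: scaleR_2 rdbar_add)
  also have "\<dots> = rdbar d i ?G x - rdbar d i (\<lambda>y. ocnj (?G y)) x"
    by (simp add: oIm_double rdbar_diff)
  also have "\<dots> = vlaplace d i v x - rdbar d i (dbar d i (\<lambda>y. ocnj (v y))) x"
    by (simp add: rdbar_rdunbar ocnj_rdunbar)
  finally show "D2_entry d i j v w x = dmixed d i j w x - rdbar d j (dbar d i (\<lambda>y. ocnj (w y))) x
    + vlaplace d i v x - rdbar d i (dbar d i (\<lambda>y. ocnj (v y))) x"
    by (simp add: D2_entry_def)
qed

lemma ocnj_dmixed_oscalar:
  "ocnj (dmixed d i j (\<lambda>x. oscalar (f x)) x) = dmixed d j i (\<lambda>x. oscalar (f x)) x"
proof -
  have "ocnj (oscalar c) = (oscalar c :: 'a oct)" for c by (simp add: oct_eq_iff oct_nth)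
  then show ?thesis by (simp add: dmixed_oscalar(1)[of i] dmixed_oscalar(2)[of j] ocnj_op)
qed

lemma D0_in_H2: "D0 d f x \<in> H2"
  by (simp add: mem_H2_iff D0_def ocnj_dmixed_oscalar oIm_oscalar)

lemma D1_entry_D0: "rdbar d j (dmixed d i j (\<lambda>x. oscalar (f x))) x
    - dbar d i (\<lambda>x. oscalar (laplace d j f x)) x = 0"
  by (simp add: dmixed_oscalar(1) rdbar_rdunbar vlaplace_dbar flip: vlaplace_oscalar)

lemma D1_D0: "D1 d (D0 d f) x = 0"
  by (simp add: D1_def D0_def vec2_eq_iff D1_entry_D0)

text \<open>
  After the Laplacians have been pulled out, the terms with \<open>a\<close> and \<open>b\<close> cancel, and those with
  \<open>q\<close> leave the difference of the two sides of \<open>dmixed_rdbar\<close>.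
\<close>

lemma D2_entry_D1:
  "D2_entry d i j (\<lambda>x. rdbar d j q x - dbar d i (\<lambda>x. oscalar (b x)) x)
     (\<lambda>x. rdbar d i (\<lambda>y. ocnj (q y)) x - dbar d j (\<lambda>x. oscalar (a x)) x) = (\<lambda>x. 0)"
proof -
  have c: "ocnj (oscalar c) = (oscalar c :: 'a oct)" for c by (simp add: oct_eq_iff oct_nth)
  have 1: "dbar d i (rdunbar d j (\<lambda>x. oscalar (a x))) = rdunbar d j (dbar d i (\<lambda>x. oscalar (a x)))"
    using dmixed_oscalar[of i j a] by simp
  have 2: "dbar d i (rdunbar d i (\<lambda>x. oscalar (b x))) = vlaplace d i (\<lambda>x. oscalar (b x))"
    using dmixed_oscalar[of i i b] by (simp add: dbar_oscalar rdunbar_rdbar)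
  have 3: "rdbar d i (vlaplace d i (\<lambda>x. oscalar (b x))) = dbar d i (vlaplace d i (\<lambda>x. oscalar (b x)))"
    by (simp add: vlaplace_oscalar dbar_oscalar)
  show ?thesis
    unfolding D2_entry_eq op_linear ocnj_diff ocnj_op c ocnj_ocnj dmixed_dbar_oscalar dmixed_rdbar
      dbar_dunbar 1 2 rdbar_rdunbar vlaplace_rdbar vlaplace_dbar 3
    by simp
qed

lemma D2_D1:
  assumes "\<And>x. u x \<in> H2"
  shows "D2 d (D1 d u) x = 0"
proof -
  define a where "a = (\<lambda>x. oRe (u x $ 1 $ 1))"
  define b where "b = (\<lambda>x. oRe (u x $ 2 $ 2))"
  define q where "q = (\<lambda>x. u x $ 1 $ 2)"
  have u: "u x $ 1 $ 1 = oscalar (a x)" "u x $ 2 $ 2 = oscalar (b x)" "u x $ 1 $ 2 = q x"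
    "u x $ 2 $ 1 = ocnj (q x)" for x
    using assms[of x] by (simp_all add: mem_H2_iff a_def b_def q_def oIm_eq_0_iff[symmetric])
  show ?thesis
    using D2_entry_D1[of 1 2 q b a] D2_entry_D1[of 2 1 "\<lambda>x. ocnj (q x)" a b]
    by (simp add: D2_eq D1_def u vec2_eq_iff)
qed

lemma oRe_D3_D2: "oRe (dunbar d j (D2_entry d j i w v) x) = 0"
proof -
  have "oRe (dunbar d j (rdbar d i (dbar d j (\<lambda>y. ocnj (v y)))) x) = oRe (dunbar d i (vlaplace d j v) x)"
    for i v
  proof -
    have "oRe (dunbar d j (rdbar d i (dbar d j (\<lambda>y. ocnj (v y)))) x)
       = oRe (rdbar d i (vlaplace d j (\<lambda>y. ocnj (v y))) x)"
      by (simp add: oRe_dunbar_rdbar dunbar_dbar)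
    also have "\<dots> = oRe (ocnj (dunbar d i (vlaplace d j v) x))"
      by (simp add: ocnj_op)
    finally show ?thesis by simp
  qed
  moreover have "oRe (x + y) = oRe x + oRe y" "oRe (x - y) = oRe x - oRe y" for x y :: "'a oct"
    by (simp_all add: oRe_def)
  ultimately show ?thesis
    unfolding D2_entry_eq op_linear by (simp add: oRe_dunbar_dmixed)
qed

text \<open>
  The terms with \<open>v\<close> and those with \<open>w\<close> vanish separately, each by \<open>rdunbar_dmixed\<close>; for one of
  them the identity is applied to the conjugate expression.
\<close>

lemma D3_offdiag_D2:
  "dbar d i (\<lambda>y. ocnj (D2_entry d j i w v y)) x + rdunbar d j (D2_entry d i j v w) x = 0"
proof -
  \<comment> \<open>the mirror image of \<open>rdunbar_dmixed\<close> with \<open>i\<close> and \<open>j\<close> exchanged\<close>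
  have 1: "dbar d i (\<lambda>y. ocnj (dmixed d j i v y)) x = rdunbar d j (rdbar d i (dbar d i (\<lambda>y. ocnj (v y)))) x"
  proof -
    have "dbar d i (\<lambda>y. ocnj (dmixed d j i v y)) x = ocnj (rdunbar d i (dmixed d j i v) x)"
      by (simp add: ocnj_op)
    then show ?thesis by (simp add: rdunbar_dmixed ocnj_op)
  qed
  show ?thesis
    unfolding D2_entry_eq op_linear ocnj_add ocnj_diff ocnj_op ocnj_ocnj 1 rdunbar_dmixed
      rdunbar_rdbar dbar_dunbar vlaplace_dbar vlaplace_rdunbar
    by simp
qed

lemma D3_D2: "D3 d (D2 d v) x = 0"
  using D3_offdiag_D2[of 1 2 "\<lambda>y. v y $ 2" "\<lambda>y. v y $ 1" x] D3_offdiag_D2[of 2 1 "\<lambda>y. v y $ 1" "\<lambda>y. v y $ 2" x]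
  by (simp add: D3_def D2_eq vec2_eq_iff oRe_D3_D2 oscalar_def add.commute)

lemma D3_in_H2: "D3 d t x \<in> H2"
proof -
  have s: "ocnj (c *\<^sub>R v) = c *\<^sub>R ocnj v" for c and v :: "'a oct" by (simp add: oct_eq_iff oct_nth)
  show ?thesis
    by (simp add: mem_H2_iff D3_def oIm_oscalar ocnj_minus ocnj_add ocnj_op s)
qed

lemma laplace_oRe: "laplace d j (\<lambda>y. oRe (F y)) x = oRe (vlaplace d j F x)"
  by (simp add: laplace_def vlaplace_def odiff_def oRe_def)

lemma D4_D3: "D4 d (D3 d t) x = 0"
proof -
  define t1 where "t1 = (\<lambda>y. t y $ 1)"
  define t2 where "t2 = (\<lambda>y. t y $ 2)"
  define G where "G = (\<lambda>y. rdunbar d 1 t2 y + dbar d 2 (\<lambda>y. ocnj (t1 y)) y)"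
  define H where "H = (\<lambda>y. - ((1/2) *\<^sub>R G y))"
  let ?T = "\<lambda>F. oRe (rdbar d 1 (dunbar d 2 F) x)"
  have oRe_add: "oRe (x + y) = oRe x + oRe y" for x y :: "'a oct"
    by (simp add: oRe_def)
  \<comment> \<open>\<open>H\<close> is \<open>- G / 2\<close>; writing this additively needs no rule for scalars under the operators\<close>
  have "H y + H y + G y = G y - G y" for y
  proof -
    have "(1/2) *\<^sub>R G y + (1/2) *\<^sub>R G y = G y"
      by (simp only: scaleR_half_double flip: scaleR_add_right)
    then show ?thesis unfolding H_def by (simp add: algebra_simps)
  qed
  then have "?T (\<lambda>y. H y + H y + G y) = ?T (\<lambda>y. G y - G y)"
    by (simp only:)
  then have "?T H + ?T H + ?T G = 0"
    unfolding op_linear oRe_add by (simp add: oRe_def)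
  moreover have "?T (rdunbar d 1 t2) = oRe (dunbar d 2 (vlaplace d 1 t2) x)"
    by (simp add: rdbar_rdunbar flip: oRe_dunbar_rdbar)
  moreover have "?T (dbar d 2 (\<lambda>y. ocnj (t1 y))) = oRe (dunbar d 1 (vlaplace d 2 t1) x)"
  proof -
    have "?T (dbar d 2 (\<lambda>y. ocnj (t1 y))) = oRe (ocnj (dunbar d 1 (vlaplace d 2 t1) x))"
      by (simp only: dunbar_dbar ocnj_op)
    then show ?thesis by simp
  qed
  ultimately have "?T H + ?T H + oRe (dunbar d 2 (vlaplace d 1 t2) x)
      + oRe (dunbar d 1 (vlaplace d 2 t1) x) = 0"
    unfolding G_def op_linear oRe_add by (simp add: add.assoc)
  moreover have "D4 d (D3 d t) x = oRe (dunbar d 2 (vlaplace d 1 t2) x) + oRe (dunbar d 1 (vlaplace d 2 t1) x) + 2 * ?T H"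
  proof -
    have o: "oRe (oscalar c) = (c :: 'a)" for c by (simp add: oct_nth)
    have "D3 d t y $ 1 $ 1 = oscalar (oRe (dunbar d 2 t2 y))"
         "D3 d t y $ 2 $ 2 = oscalar (oRe (dunbar d 1 t1 y))"
         "D3 d t y $ 2 $ 1 = H y" for y
      by (simp_all add: D3_def t1_def t2_def H_def G_def)
    then show ?thesis
      by (simp add: D4_def o laplace_oRe vlaplace_dunbar)
  qed
  ultimately show ?thesis by (simp add: algebra_simps)
qed

end

section \<open>Exactness of the symbol sequence\<close>

lemma commuting_partials_symb: "commuting_partials (symb \<xi>)"
  by standard (auto simp: symb_def fun_eq_iff algebra_simps)

definition ocomplex :: "real oct \<Rightarrow> complex oct" where
  "ocomplex x = (\<chi> a. of_real (x $ a))"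

lemma ocomplex_eq_sum: "(\<Sum>a\<in>UNIV. complex_of_real (x $ a) *s oe a) = ocomplex x"
  by (simp add: oct_eq_iff sum_8 oe_nth ocomplex_def)

lemma ocnj_ocomplex_eq_sum: "(\<Sum>a\<in>UNIV. complex_of_real (x $ a) *s ocnj (oe a)) = ocnj (ocomplex x)"
  by (simp add: ocnj_sum ocnj_scale flip: ocomplex_eq_sum)

lemma odiff_symb: "odiff (symb \<xi>) j a F x = \<i> *s (complex_of_real (\<xi> $ j $ a) *s F x)"
  by (simp add: odiff_def symb_def vec_eq_iff)

lemma dbar_symb: "dbar (symb \<xi>) j F x = \<i> *s (ocomplex (\<xi> $ j) \<odot> F x)"
  and rdbar_symb: "rdbar (symb \<xi>) j F x = \<i> *s (F x \<odot> ocomplex (\<xi> $ j))"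
  unfolding dbar_def rdbar_def odiff_symb ocomplex_eq_sum[symmetric]
  by (simp_all add: omult_scale_left omult_scale_right omult_sum_left omult_sum_right vec.scale_sum_right)

lemma dunbar_symb: "dunbar (symb \<xi>) j F x = \<i> *s (ocnj (ocomplex (\<xi> $ j)) \<odot> F x)"
  and rdunbar_symb: "rdunbar (symb \<xi>) j F x = \<i> *s (F x \<odot> ocnj (ocomplex (\<xi> $ j)))"
  unfolding dunbar_def rdunbar_def odiff_symb ocnj_ocomplex_eq_sum[symmetric]
  by (simp_all add: omult_scale_left omult_scale_right omult_sum_left omult_sum_right vec.scale_sum_right)

lemma i_times_i_times: "\<i> * (r * (\<i> * (s * z))) = - (r * (s * z))"
proof -
  have "\<i> * (r * (\<i> * (s * z))) = (\<i> * \<i>) * (r * (s * z))" by (simp only: ac_simps)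
  then show ?thesis by simp
qed

lemma dmixed_symb: "dmixed (symb \<xi>) i j F x
    = - ((ocomplex (\<xi> $ i) \<odot> ocnj (ocomplex (\<xi> $ j))) \<odot> F x)"
proof -
  have "odiff (symb \<xi>) i a (odiff (symb \<xi>) j b F) x
     = - (complex_of_real (\<xi> $ i $ a) *s (complex_of_real (\<xi> $ j $ b) *s F x))" for a b
    by (simp only: odiff_symb vec_eq_iff vector_smult_component vector_uminus_component i_times_i_times simp_thms)
  then have "dmixed (symb \<xi>) i j F x = - (\<Sum>a\<in>UNIV. \<Sum>b\<in>UNIV.
      (((complex_of_real (\<xi> $ i $ a) *s oe a) \<odot> (complex_of_real (\<xi> $ j $ b) *s ocnj (oe b))) \<odot> F x))"
    by (simp add: dmixed_def omult_minus_right omult_scale_left omult_scale_right sum_negf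
        mult.commute[of "complex_of_real (\<xi> $ j $ _)"])
  also have "\<dots> = - ((ocomplex (\<xi> $ i) \<odot> ocnj (ocomplex (\<xi> $ j))) \<odot> F x)"
    unfolding ocnj_ocomplex_eq_sum[symmetric] unfolding ocomplex_eq_sum[symmetric]
    by (simp only: omult_sum_left omult_sum_right) (subst sum.swap, rule refl)
  finally show ?thesis .
qed

lemma laplace_symb: "laplace (symb \<xi>) j f x = - (onorm2 (ocomplex (\<xi> $ j)) * f x)"
  by (simp only: laplace_def symb_def onorm2_def ocomplex_def vec_lambda_beta mult.assoc i_times_i_times
      sum_negf sum_distrib_right)

lemma onorm2_ocomplex: "onorm2 (ocomplex x) \<noteq> 0" if "x \<noteq> 0"
proof -
  have "onorm2 (ocomplex x) = complex_of_real (\<Sum>a\<in>UNIV. (x $ a)\<^sup>2)"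
    by (simp add: onorm2_def ocomplex_def power2_eq_square)
  moreover have "(\<Sum>a\<in>UNIV. (x $ a)\<^sup>2) \<noteq> 0"
    using that by (simp add: sum_nonneg_eq_0_iff vec_eq_iff)
  ultimately show ?thesis by (simp only: of_real_eq_0_iff not_False_eq_True)
qed

text \<open>
  Which of \<open>\<xi>\<^sub>1\<close>, \<open>\<xi>\<^sub>2\<close> is nonzero is not known, so everything is stated for a pair \<open>i \<noteq> j\<close>
  of indices instead of \<open>1\<close> and \<open>2\<close>.
\<close>

lemma index2_cases: assumes "i \<noteq> (j::2)" obtains "i = 1" "j = 2" | "i = 2" "j = 1"
  using assms exhaust_2[of i] exhaust_2[of j] by auto

lemma vec2_eqI: "i \<noteq> j \<Longrightarrow> x $ i = y $ i \<Longrightarrow> x $ j = y $ j \<Longrightarrow> (x::'a^2) = y"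
  using exhaust_2[of i] exhaust_2[of j] by (auto simp: vec2_eq_iff)

lemma vec22_eqI: "i \<noteq> j \<Longrightarrow> x$i$i = y$i$i \<Longrightarrow> x$i$j = y$i$j \<Longrightarrow> x$j$i = y$j$i \<Longrightarrow> x$j$j = y$j$j
    \<Longrightarrow> (x::'a^2^2) = y"
  using exhaust_2[of i] exhaust_2[of j] by (auto simp: vec2_eq_iff)

lemma mem_H2_iff': "i \<noteq> j \<Longrightarrow> u \<in> H2 \<longleftrightarrow>
  oIm (u$i$i) = 0 \<and> oIm (u$j$j) = 0 \<and> u$j$i = ocnj (u$i$j)"
  by (erule index2_cases) (auto simp: mem_H2_iff)

context
  fixes \<xi> :: "real oct^2" and i j :: 2
  assumes ij: "i \<noteq> j"
begin

abbreviation "X k \<equiv> ocomplex (\<xi> $ k)"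

lemma sigma0_nth:
  "sigma0 \<xi> f $ i $ i = oscalar (- onorm2 (X i) * f)"
  "sigma0 \<xi> f $ j $ j = oscalar (- onorm2 (X j) * f)"
  "sigma0 \<xi> f $ i $ j = - f *s (X i \<odot> ocnj (X j))"
  using ij by (auto elim!: index2_cases simp: sigma0_def D0_def laplace_symb dmixed_symb omult_oscalar)

lemma sigma1_nth:
  "sigma1 \<xi> u $ i = \<i> *s (u$i$j \<odot> X j - X i \<odot> u$j$j)"
  "sigma1 \<xi> u $ j = \<i> *s (u$j$i \<odot> X i - X j \<odot> u$i$i)"
  using ij by (auto elim!: index2_cases simp: sigma1_def D1_def rdbar_symb dbar_symb vector_ssub_ldistrib)

lemma sigma2_nth:
  "sigma2 \<xi> v $ i = (X i \<odot> ocnj (v$j)) \<odot> X j - (X i \<odot> ocnj (X j)) \<odot> v$j - (2 *s oIm (v$i \<odot> ocnj (X i))) \<odot> X i"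
  "sigma2 \<xi> v $ j = (X j \<odot> ocnj (v$i)) \<odot> X i - (X j \<odot> ocnj (X i)) \<odot> v$i - (2 *s oIm (v$j \<odot> ocnj (X j))) \<odot> X j"
proof -
  have 2: "2 *\<^sub>R x = 2 *s (x :: complex oct)" for x by (simp add: vec_eq_iff scaleR_conv_of_real)
  show "sigma2 \<xi> v $ i = (X i \<odot> ocnj (v$j)) \<odot> X j - (X i \<odot> ocnj (X j)) \<odot> v$j - (2 *s oIm (v$i \<odot> ocnj (X i))) \<odot> X i"
  "sigma2 \<xi> v $ j = (X j \<odot> ocnj (v$i)) \<odot> X i - (X j \<odot> ocnj (X i)) \<odot> v$i - (2 *s oIm (v$j \<odot> ocnj (X j))) \<odot> X j"
  using ij unfolding sigma2_def D2_def 2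
  by (auto elim!: index2_cases simp: dmixed_symb rdbar_symb rdunbar_symb dbar_symb omult_scale_left
     oIm_scale)
qed

lemma sigma3_nth:
  "sigma3 \<xi> t $ i $ i = oscalar (\<i> * oRe (ocnj (X j) \<odot> t$j))"
  "sigma3 \<xi> t $ j $ j = oscalar (\<i> * oRe (ocnj (X i) \<odot> t$i))"
  "sigma3 \<xi> t $ i $ j = - (\<i> / 2) *s (X i \<odot> ocnj (t$j) + t$i \<odot> ocnj (X j))"
proof -
  have h: "(1/2) *\<^sub>R x = (1/2) *s (x :: complex oct)" for x
  proof -
    have "((1/2) *\<^sub>R x) $ k = ((1/2) *s x) $ k" for k
      by (simp only: vector_scaleR_component vector_smult_component) (simp only: scaleR_conv_of_real, simp)
    then show ?thesis by (simp only: vec_eq_iff simp_thms)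
  qed
  have r: "oRe (c *s x) = c * oRe x" for c and x :: "complex oct" by (simp add: oRe_def)
  show "sigma3 \<xi> t $ i $ i = oscalar (\<i> * oRe (ocnj (X j) \<odot> t$j))"
  "sigma3 \<xi> t $ j $ j = oscalar (\<i> * oRe (ocnj (X i) \<odot> t$i))"
  "sigma3 \<xi> t $ i $ j = - (\<i> / 2) *s (X i \<odot> ocnj (t$j) + t$i \<odot> ocnj (X j))"
  using ij unfolding sigma3_def D3_def h
  by (auto elim!: index2_cases simp: rdunbar_symb dbar_symb dunbar_symb r vector_add_ldistrib add.commute)
qed

end

text \<open>
  The last term is not visibly symmetric in the two indices, although on \<open>H2\<close> it is. Only its
  dependence on the entry with index \<open>2, 1\<close> matters.
\<close>

lemma sigma4_eq: "sigma4 \<xi> s = - (onorm2 (X \<xi> 1) * oRe (s$1$1)) - onorm2 (X \<xi> 2) * oRe (s$2$2)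
   - 2 * oRe ((ocnj (X \<xi> 2) \<odot> s$2$1) \<odot> X \<xi> 1)"
  by (simp add: sigma4_def D4_def laplace_symb rdbar_symb dunbar_symb omult_scale_left oRe_def)

lemma sigma_in_H2: "sigma0 \<xi> f \<in> H2" "sigma3 \<xi> t \<in> H2"
  by (simp_all add: sigma0_def sigma3_def commuting_partials.D0_in_H2[OF commuting_partials_symb]
    commuting_partials.D3_in_H2[OF commuting_partials_symb])

lemma unit_fun: "(\<lambda>_. F ()) = (F :: unit \<Rightarrow> _)" by (simp add: fun_eq_iff)

lemma sigma1_sigma0: "sigma1 \<xi> (sigma0 \<xi> f) = 0"
  and sigma2_sigma1: "u \<in> H2 \<Longrightarrow> sigma2 \<xi> (sigma1 \<xi> u) = 0"
  and sigma3_sigma2: "sigma3 \<xi> (sigma2 \<xi> v) = 0"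
  and sigma4_sigma3: "sigma4 \<xi> (sigma3 \<xi> t) = 0"
  unfolding sigma0_def sigma1_def sigma2_def sigma3_def sigma4_def unit_fun
  by (simp_all add: commuting_partials.D1_D0[OF commuting_partials_symb] commuting_partials.D2_D1[OF commuting_partials_symb]
    commuting_partials.D3_D2[OF commuting_partials_symb] commuting_partials.D4_D3[OF commuting_partials_symb])

context
  fixes Y :: "complex oct"
  assumes Y: "onorm2 Y \<noteq> 0"
begin

lemma omult_left_cancel: "Y \<odot> p = Y \<odot> q \<longleftrightarrow> p = q"
proof
  assume "Y \<odot> p = Y \<odot> q"
  then have "ocnj Y \<odot> (Y \<odot> p) = ocnj Y \<odot> (Y \<odot> q)" by (rule arg_cong)
  then show "p = q" using Y by (simp only: omult_cnj_left' vector_mul_lcancel simp_thms)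
qed simp

lemma omult_right_cancel: "p \<odot> Y = q \<odot> Y \<longleftrightarrow> p = q"
proof
  assume "p \<odot> Y = q \<odot> Y"
  then have "(p \<odot> Y) \<odot> ocnj Y = (q \<odot> Y) \<odot> ocnj Y" by (rule arg_cong)
  then show "p = q" using Y by (simp only: omult_cnj_right vector_mul_lcancel simp_thms)
qed simp

end

text \<open>
  Below \<open>A = \<xi>\<^sub>i\<close>, \<open>B = \<xi>\<^sub>j\<close> and \<open>N = \<bar>B\<bar>\<^sup>2\<close>; all preimages come from solving for one entry by
  means of \<open>(z B') B = N z\<close>.
\<close>

lemma symbol_exact_index:
  assumes ij: "i \<noteq> (j::2)" and xj: "\<xi> $ j \<noteq> 0"
  shows "symbol_sequence_exact \<xi>"
proof -
  define A where "A = ocomplex (\<xi> $ i)"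
  define B where "B = ocomplex (\<xi> $ j)"
  define N where "N = onorm2 B"
  have N: "N \<noteq> 0" using onorm2_ocomplex[OF xj] by (simp add: N_def B_def)
  have NB: "onorm2 B \<noteq> 0" "onorm2 (ocnj B) \<noteq> 0" using N by (simp_all add: N_def onorm2_ocnj)
  note s0 = sigma0_nth[OF ij, of \<xi>, folded A_def B_def, folded N_def]
  note s1 = sigma1_nth[OF ij, of \<xi>, folded A_def B_def]
  note s2 = sigma2_nth[OF ij, of \<xi>, folded A_def B_def]
  note s3 = sigma3_nth[OF ij, of \<xi>, folded A_def B_def]
  note H = mem_H2_iff'[OF ij]
  note BB = omult_cnj_left[of B, folded N_def] omult_cnj_left'[of B, folded N_def]
    omult_cnj_right[of _ B, folded N_def] omult_cnj_right'[of _ B, folded N_def]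
  have i0: "\<i> *s x = 0 \<longleftrightarrow> x = 0" for x :: "complex oct" by (simp add: vec_eq_iff)

  have e0: "exact_at (\<lambda>_. 0) {0} UNIV (sigma0 \<xi>)"
  proof -
    have "sigma0 \<xi> 0 = 0"
      using sigma_in_H2(1)[of \<xi> 0]
      by (intro vec22_eqI[OF ij]) (simp_all add: H s0 oct_eq_iff oct_nth)
    moreover have "f = 0" if "sigma0 \<xi> f = 0" for f
      using that s0(2)[of f] N by (simp add: oct_eq_iff oct_nth)
    ultimately show ?thesis by (auto simp: exact_at_def)
  qed

  have e1: "exact_at (sigma0 \<xi>) UNIV H2 (sigma1 \<xi>)"
  proof -
    have "u \<in> range (sigma0 \<xi>)" if u: "u \<in> H2" "sigma1 \<xi> u = 0" for u
    proof -
      obtain b where b: "u$j$j = oscalar b" using u(1) by (auto simp: H oIm_eq_0_iff)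
      \<comment> \<open>The entry \<open>j, j\<close> determines the scalar; \<open>sigma1 \<xi> u = 0\<close> then determines the other entries.\<close>
      define u' where "u' = sigma0 \<xi> (- b / N)"
      have u': "u' \<in> H2" "sigma1 \<xi> u' = 0"
        by (simp_all add: u'_def sigma_in_H2 sigma1_sigma0)
      have eq: "w$i$j \<odot> B = A \<odot> w$j$j" "w$j$i \<odot> A = B \<odot> w$i$i" if "sigma1 \<xi> w = 0" for w
        using s1[of w] that by (simp_all add: i0)
      have jj: "u'$j$j = u$j$j" using N by (simp add: u'_def s0 b)
      have "u'$i$j \<odot> B = u$i$j \<odot> B"
        using eq(1)[OF u(2)] eq(1)[OF u'(2)] jj by simp
      then have ij': "u'$i$j = u$i$j" by (simp add: omult_right_cancel NB)
      then have ji: "u'$j$i = u$j$i" using u(1) u'(1) by (simp add: H)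
      then have "B \<odot> u'$i$i = B \<odot> u$i$i" using eq(2)[OF u(2)] eq(2)[OF u'(2)] by simp
      then have "u'$i$i = u$i$i" by (simp add: omult_left_cancel NB)
      with jj ij' ji have "u' = u"
        by (intro vec22_eqI[OF ij])
      then show ?thesis by (auto simp: u'_def)
    qed
    then show ?thesis by (auto simp: exact_at_def sigma_in_H2 sigma1_sigma0)
  qed

  have e2: "exact_at (sigma1 \<xi>) H2 UNIV (sigma2 \<xi>)"
  proof -
    have "v \<in> sigma1 \<xi> ` H2" if v: "sigma2 \<xi> v = 0" for v
    proof -
      \<comment> \<open>\<open>q\<close> is chosen to match component \<open>i\<close> of \<open>v\<close>; the scalar \<open>a\<close> is free and will match component \<open>j\<close>.\<close>
      define q where "q = (- \<i> / N) *s (v$i \<odot> ocnj B)"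
      define u where "u a = (\<chi> k l. if k = l then (if k = i then oscalar a else 0)
          else if k = i then q else ocnj q)" for a :: complex
      have u_nth: "u a $ i $ i = oscalar a" "u a $ i $ j = q" "u a $ j $ i = ocnj q" "u a $ j $ j = 0" for a
        using ij by (simp_all add: u_def)
      have uH: "u a \<in> H2" for a
        by (auto simp: H u_nth oct_nth oct_eq_iff)
      define w where "w = sigma1 \<xi> (u 0)"
      have w: "sigma2 \<xi> w = 0" using uH by (simp add: w_def sigma2_sigma1)
      have vi: "sigma1 \<xi> (u a) $ i = v $ i" for a
        using N by (simp add: s1 u_nth q_def omult_scale_left omult_minus_left BB omult_zero_right)
      then have wi: "w $ i = v $ i" by (simp add: w_def)
      \<comment> \<open>\<open>v\<close> and \<open>w\<close> are in the kernel and have the same component \<open>i\<close>, so that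
        \<open>(v\<^sub>j - w\<^sub>j) B'\<close> is a scalar and \<open>v\<^sub>j - w\<^sub>j\<close> a multiple of \<open>B\<close>.\<close>
      have eq: "(2 *s oIm (v$j \<odot> ocnj B)) \<odot> B = (2 *s oIm (w$j \<odot> ocnj B)) \<odot> B"
        using s2(2)[of v] s2(2)[of w] v w wi by simp
      then have im: "oIm (v$j \<odot> ocnj B) = oIm (w$j \<odot> ocnj B)"
        by (simp add: omult_right_cancel NB)
      define c where "c = oRe (v$j \<odot> ocnj B) - oRe (w$j \<odot> ocnj B)"
      have "v$j \<odot> ocnj B = w$j \<odot> ocnj B + oscalar c"
        using im by (simp add: oct_eq_iff c_def oIm_def oRe_def oscalar_nth)
      then have "(v$j \<odot> ocnj B) \<odot> B = (w$j \<odot> ocnj B + oscalar c) \<odot> B" by simp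
      then have "N *s (v$j) = N *s (w$j) + c *s B"
        by (simp add: BB omult_add_left omult_oscalar)
      then have vj: "v$j = w$j + (c / N) *s B"
        using N by (simp add: vec_eq_iff field_simps)
      have "sigma1 \<xi> (u (\<i> * c / N)) $ j = v $ j"
        unfolding vj by (simp add: w_def s1 u_nth omult_oscalar omult_zero_right vec_eq_iff algebra_simps)
      then have "sigma1 \<xi> (u (\<i> * c / N)) = v"
        using vi by (intro vec2_eqI[OF ij])
      then show ?thesis using uH by blast
    qed
    then show ?thesis by (auto simp: exact_at_def sigma2_sigma1)
  qed

  have e3: "exact_at (sigma2 \<xi>) UNIV UNIV (sigma3 \<xi>)"
  proof -
    have "t \<in> range (sigma2 \<xi>)" if t: "sigma3 \<xi> t = 0" for t
    proof -
      \<comment> \<open>\<open>t\<^sub>j B'\<close> is imaginary, so the third term of \<open>sigma2\<close> alone reproduces \<open>t\<^sub>j\<close> up to the factor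
        \<open>- 2 N\<close>; component \<open>i\<close> is then forced, both vectors being in the kernel of \<open>sigma3\<close>.\<close>
      define v where "v = (\<chi> k. if k = j then (- 1 / (2 * N)) *s t$j else 0)"
      have v: "v $ i = 0" "v $ j = (- 1 / (2 * N)) *s t$j" using ij by (simp_all add: v_def)
      have "oRe (t$j \<odot> ocnj B) = 0"
        using s3(1)[of t] t by (simp add: oRe_commute[of "t$j"] oct_eq_iff oscalar_nth)
      then have im: "oIm (t$j \<odot> ocnj B) = t$j \<odot> ocnj B"
        by (simp add: oct_eq_iff oIm_def oRe_def)
      have tj: "sigma2 \<xi> v $ j = t $ j"
        using N by (simp add: s2 v ocnj_zero omult_zero_left omult_zero_right omult_scale_left
              omult_minus_left oIm_scale oIm_minus im BB)
      have "sigma3 \<xi> (sigma2 \<xi> v) = 0" by (rule sigma3_sigma2)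
      then have "A \<odot> ocnj (t$j) + sigma2 \<xi> v $ i \<odot> ocnj B = A \<odot> ocnj (t$j) + t$i \<odot> ocnj B"
        using s3(3)[of t] s3(3)[of "sigma2 \<xi> v"] t tj by (simp add: i0)
      then have "sigma2 \<xi> v $ i = t $ i" by (simp add: omult_right_cancel NB)
      with tj have "sigma2 \<xi> v = t" by (intro vec2_eqI[OF ij])
      then show ?thesis by blast
    qed
    then show ?thesis by (auto simp: exact_at_def sigma3_sigma2)
  qed

  have e4: "exact_at (sigma3 \<xi>) UNIV H2 (sigma4 \<xi>)"
  proof -
    have "s \<in> range (sigma3 \<xi>)" if s: "s \<in> H2" "sigma4 \<xi> s = 0" for s
    proof -
      obtain a where a: "s$i$i = oscalar a" using s(1) by (auto simp: H oIm_eq_0_iff)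
      \<comment> \<open>\<open>t\<^sub>j\<close> matches the entry \<open>i, i\<close> and \<open>t\<^sub>i\<close> the entry \<open>i, j\<close>; the entry \<open>j, j\<close> follows since
        \<open>N \<noteq> 0\<close> is its coefficient in \<open>sigma4\<close>, which kills both matrices.\<close>
      define tj where "tj = (- \<i> * a / N) *s B"
      define ti where "ti = (1 / N) *s (((2 * \<i>) *s s$i$j - A \<odot> ocnj tj) \<odot> B)"
      define t where "t = (\<chi> k. if k = j then tj else ti)"
      have t: "t $ i = ti" "t $ j = tj" using ij by (simp_all add: t_def)
      have "oRe (ocnj B \<odot> B) = N"
        by (simp add: oct_nth N_def onorm2_def sum_8)
      then have ii: "sigma3 \<xi> t $ i $ i = s $ i $ i"
        using N by (simp add: s3 a t tj_def omult_scale_right omult_minus_right) (simp add: oRe_def)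
      have "ti \<odot> ocnj B = (2 * \<i>) *s s$i$j - A \<odot> ocnj tj"
        using N by (simp add: ti_def omult_scale_left BB)
      then have ij': "sigma3 \<xi> t $ i $ j = s $ i $ j"
        by (simp add: s3 t)
      have t4: "sigma3 \<xi> t \<in> H2" "sigma4 \<xi> (sigma3 \<xi> t) = 0"
        by (simp_all add: sigma_in_H2 sigma4_sigma3)
      have ji: "sigma3 \<xi> t $ j $ i = s $ j $ i"
        using s(1) t4(1) ij' by (simp add: H)
      have "sigma4 \<xi> (sigma3 \<xi> t) + N * oRe (sigma3 \<xi> t $ j $ j) = sigma4 \<xi> s + N * oRe (s $ j $ j)"
        using ij ii ij' ji
        by (auto elim!: index2_cases simp: sigma4_eq N_def A_def B_def)
      then have "oRe (sigma3 \<xi> t $ j $ j) = oRe (s $ j $ j)"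
        using N s(2) t4(2) by simp
      then have jj: "sigma3 \<xi> t $ j $ j = s $ j $ j"
        using s(1) t4(1) by (simp add: H oct_eq_iff oct_nth)
      from ii ij' ji jj have "sigma3 \<xi> t = s"
        by (intro vec22_eqI[OF ij])
      then show ?thesis by blast
    qed
    then show ?thesis by (auto simp: exact_at_def sigma_in_H2 sigma4_sigma3)
  qed

  have e5: "exact_at (sigma4 \<xi>) H2 UNIV (\<lambda>_. 0::complex)"
  proof -
    have "c \<in> sigma4 \<xi> ` H2" for c
    proof -
      define s :: "complex oct^2^2" where "s = (\<chi> k l. if k = j \<and> l = j then oscalar (- c / N) else 0)"
      have "s \<in> H2" using ij by (auto simp: H s_def oct_eq_iff oct_nth)
      moreover have "sigma4 \<xi> s = c"
        using ij N by (auto elim!: index2_cases simp: s_def sigma4_eq N_def B_def oRe_def oscalar_nth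
          omult_zero_left omult_zero_right)
      ultimately show ?thesis by blast
    qed
    then show ?thesis by (auto simp: exact_at_def)
  qed
  show ?thesis using e0 e1 e2 e3 e4 e5 by (simp add: symbol_sequence_exact_def)
qed

lemma symbol_exact: "symbol_sequence_exact \<xi>" if "\<xi> \<noteq> 0"
proof -
  have "\<xi> $ 1 \<noteq> 0 \<or> \<xi> $ 2 \<noteq> 0" using that by (auto simp: vec2_eq_iff)
  then show ?thesis using symbol_exact_index[of 2 1 \<xi>] symbol_exact_index[of 1 2 \<xi>] by auto
qed

section \<open>Smooth functions and the symmetry of second derivatives\<close>

text \<open>
  The mean value theorem in direction \<open>u\<close> turns the second difference into a difference of first
  derivatives, and differentiability of \<open>g\<close> at the single point \<open>x\<close> controls the latter. The
  quotient is symmetric in \<open>u\<close> and \<open>v\<close>, so the limits \<open>G v\<close> for the two orders of differentiation agree.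
\<close>

lemma second_difference_quotient:
  fixes f g :: "'e::real_normed_vector \<Rightarrow> real"
  assumes "open \<Omega>" "x \<in> \<Omega>"
    and deriv: "\<And>y. y \<in> \<Omega> \<Longrightarrow> ((\<lambda>t. f (y + t *\<^sub>R u)) has_real_derivative g y) (at 0)"
    and G: "(g has_derivative G) (at x)"
  shows "((\<lambda>h. (f (x + h *\<^sub>R u + h *\<^sub>R v) - f (x + h *\<^sub>R u) - f (x + h *\<^sub>R v) + f x) / h\<^sup>2) \<longlongrightarrow> G v) (at_right 0)"
proof (rule tendstoI)
  fix e :: real assume "e > 0"
  \<comment> \<open>\<open>c h\<close> bounds the sum of the distances from \<open>x\<close> of the two points at which \<open>g\<close> is compared.\<close>
  define c where "c = 2 * norm u + norm v + 1"
  have c: "c > 0" by (simp add: c_def add_nonneg_pos)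
  obtain \<delta> where \<delta>: "\<delta> > 0" "\<And>y. norm (y - x) < \<delta> \<Longrightarrow> norm (g y - g x - G (y - x)) \<le> (e / c) * norm (y - x)"
    using G \<open>e > 0\<close> c unfolding has_derivative_at_alt by (metis divide_pos_pos)
  obtain r where r: "r > 0" "ball x r \<subseteq> \<Omega>" using assms(1,2) open_contains_ball by blast
  define \<eta> where "\<eta> = min \<delta> r / c"
  have "\<eta> > 0" using \<delta> r c by (simp add: \<eta>_def)
  have bound: "norm (s *\<^sub>R u + t *\<^sub>R v) < min \<delta> r" if "0 \<le> s" "s \<le> h" "0 \<le> t" "t \<le> h" "0 < h" "h < \<eta>" for s t h
  proof -
    have "norm (s *\<^sub>R u + t *\<^sub>R v) \<le> s * norm u + t * norm v"
      using norm_triangle_ineq[of "s *\<^sub>R u" "t *\<^sub>R v"] that by simp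
    also have "\<dots> \<le> h * norm u + h * norm v"
      using that by (intro add_mono mult_right_mono) auto
    also have "\<dots> \<le> h * c" using that by (simp add: c_def algebra_simps)
    also have "\<dots> < min \<delta> r" using that c by (simp add: \<eta>_def pos_less_divide_eq)
    finally show ?thesis .
  qed
  have main: "dist ((f (x + h *\<^sub>R u + h *\<^sub>R v) - f (x + h *\<^sub>R u) - f (x + h *\<^sub>R v) + f x) / h\<^sup>2) (G v) < e"
    if h: "0 < h" "h < \<eta>" for h
  proof -
    have in_\<Omega>: "x + s *\<^sub>R u + t *\<^sub>R v \<in> \<Omega>" if "0 \<le> s" "s \<le> h" "0 \<le> t" "t \<le> h" for s t
      using bound[of s h t] that h r(2) by (auto simp: subset_iff dist_norm norm_minus_commute add.assoc)
    have line: "((\<lambda>s. f (y + s *\<^sub>R u)) has_real_derivative g (y + s *\<^sub>R u)) (at s)"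
      if "y + s *\<^sub>R u \<in> \<Omega>" for y s
      using DERIV_shift[of "\<lambda>s. f (y + s *\<^sub>R u)" "g (y + s *\<^sub>R u)" 0 s] deriv[OF that]
      by (simp add: algebra_simps)
    define \<phi> where "\<phi> s = f (x + s *\<^sub>R u + h *\<^sub>R v) - f (x + s *\<^sub>R u)" for s
    have "(\<phi> has_real_derivative g (x + s *\<^sub>R u + h *\<^sub>R v) - g (x + s *\<^sub>R u)) (at s)" if "0 \<le> s" "s \<le> h" for s
    proof -
      have "((\<lambda>s. f ((x + h *\<^sub>R v) + s *\<^sub>R u)) has_real_derivative g ((x + h *\<^sub>R v) + s *\<^sub>R u)) (at s)"
        using in_\<Omega>[of s h] that h by (intro line) (simp add: algebra_simps)
      moreover have "((\<lambda>s. f (x + s *\<^sub>R u)) has_real_derivative g (x + s *\<^sub>R u)) (at s)"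
        using in_\<Omega>[of s 0] that h by (intro line) simp
      ultimately show ?thesis
        unfolding \<phi>_def by (auto intro!: DERIV_diff simp: algebra_simps)
    qed
    then obtain s where s: "0 < s" "s < h" "\<phi> h - \<phi> 0 = (h - 0) * (g (x + s *\<^sub>R u + h *\<^sub>R v) - g (x + s *\<^sub>R u))"
      using MVT2[of 0 h \<phi> "\<lambda>s. g (x + s *\<^sub>R u + h *\<^sub>R v) - g (x + s *\<^sub>R u)"] h by auto
    interpret G: bounded_linear G using G by (rule has_derivative_bounded_linear)
    define R where "R w = g (x + w) - g x - G w" for w
    have R: "\<bar>R w\<bar> \<le> e / c * norm w" if "norm w < \<delta>" for w
      using \<delta>(2)[of "x + w"] that by (simp add: R_def)
    have diff_eq: "\<phi> h - \<phi> 0 = h * (h * G v + R (s *\<^sub>R u + h *\<^sub>R v) - R (s *\<^sub>R u))"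
      unfolding s(3) R_def by (simp add: G.add G.scaleR algebra_simps)
    then have "(\<phi> h - \<phi> 0) / h\<^sup>2 - G v = (R (s *\<^sub>R u + h *\<^sub>R v) - R (s *\<^sub>R u)) / h"
    proof -
      have "h * (h * p + q - r) / h\<^sup>2 - p = (q - r) / h" for p q r
        using h by (simp add: field_simps power2_eq_square)
      then show ?thesis by (simp only: diff_eq)
    qed
    moreover have "\<bar>R (s *\<^sub>R u + h *\<^sub>R v) - R (s *\<^sub>R u)\<bar> < e * h"
    proof -
      have "\<bar>R (s *\<^sub>R u + h *\<^sub>R v) - R (s *\<^sub>R u)\<bar> \<le> \<bar>R (s *\<^sub>R u + h *\<^sub>R v)\<bar> + \<bar>R (s *\<^sub>R u)\<bar>" by simp
      also have "\<dots> \<le> e / c * norm (s *\<^sub>R u + h *\<^sub>R v) + e / c * norm (s *\<^sub>R u)"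
        using bound[of s h h] bound[of s h 0] s h by (intro add_mono R) auto
      also have "\<dots> = e / c * (norm (s *\<^sub>R u + h *\<^sub>R v) + norm (s *\<^sub>R u))"
        by (simp add: distrib_left)
      also have "\<dots> < e / c * (h * c)"
      proof (rule mult_strict_left_mono)
        have "norm (s *\<^sub>R u + h *\<^sub>R v) \<le> s * norm u + h * norm v"
          using norm_triangle_ineq[of "s *\<^sub>R u" "h *\<^sub>R v"] s h by simp
        moreover have "s * norm u \<le> h * norm u" using s by (intro mult_right_mono) auto
        ultimately show "norm (s *\<^sub>R u + h *\<^sub>R v) + norm (s *\<^sub>R u) < h * c"
          using s h by (simp add: c_def algebra_simps)
      qed (use \<open>e > 0\<close> c in simp)
      also have "\<dots> = e * h" using c by simp
      finally show ?thesis .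
    qed
    moreover have "\<phi> h - \<phi> 0 = f (x + h *\<^sub>R u + h *\<^sub>R v) - f (x + h *\<^sub>R u) - f (x + h *\<^sub>R v) + f x"
      by (simp add: \<phi>_def)
    ultimately show ?thesis using h by (simp add: dist_real_def pos_divide_less_eq)
  qed
  show "\<forall>\<^sub>F h in at_right 0. dist ((f (x + h *\<^sub>R u + h *\<^sub>R v) - f (x + h *\<^sub>R u) - f (x + h *\<^sub>R v) + f x) / h\<^sup>2) (G v) < e"
    using main \<open>\<eta> > 0\<close> unfolding eventually_at_right_field by blast
qed

lemma pd_has_derivative:
  assumes "(F has_derivative F') (at x)"
  shows "((\<lambda>t. F (x + t *\<^sub>R axis j (axis a 1))) has_vector_derivative F' (axis j (axis a 1))) (at 0)"
    and "pd j a F x = F' (axis j (axis a 1))"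
proof -
  let ?e = "axis j (axis a 1) :: real oct^2"
  have "((\<lambda>t. x + t *\<^sub>R ?e) has_derivative (\<lambda>t. t *\<^sub>R ?e)) (at 0)"
    by (auto intro!: derivative_eq_intros)
  then have "((\<lambda>t. F (x + t *\<^sub>R ?e)) has_derivative (\<lambda>t. F' (t *\<^sub>R ?e))) (at 0)"
    using has_derivative_compose[of "\<lambda>t. x + t *\<^sub>R ?e" "\<lambda>t. t *\<^sub>R ?e" 0 UNIV F F'] assms by simp
  moreover have "F' (t *\<^sub>R ?e) = t *\<^sub>R F' ?e" for t
    using has_derivative_bounded_linear[OF assms] by (rule linear_cmul[OF bounded_linear.linear])
  ultimately show *: "((\<lambda>t. F (x + t *\<^sub>R ?e)) has_vector_derivative F' ?e) (at 0)"
    by (simp add: has_vector_derivative_def)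
  then show "pd j a F x = F' ?e"
    unfolding pd_def by (rule vector_derivative_at)
qed

lemma pd_linear:
  assumes "bounded_linear L" "F differentiable (at x)"
  shows "pd j a (\<lambda>y. L (F y)) x = L (pd j a F x)"
proof -
  obtain F' where F': "(F has_derivative F') (at x)" using assms(2) by (auto simp: differentiable_def)
  then have "((\<lambda>y. L (F y)) has_derivative (\<lambda>h. L (F' h))) (at x)"
    by (rule bounded_linear.has_derivative[OF assms(1)])
  then show ?thesis using F' by (simp add: pd_has_derivative(2))
qed

lemma pd_add:
  assumes "F differentiable (at x)" "G differentiable (at x)"
  shows "pd j a (\<lambda>y. F y + G y) x = pd j a F x + pd j a G x"
proof -
  obtain F' G' where "(F has_derivative F') (at x)" "(G has_derivative G') (at x)"
    using assms by (auto simp: differentiable_def)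
  then show ?thesis
    using pd_has_derivative(2)[OF has_derivative_add] by (simp add: pd_has_derivative(2))
qed

context
  fixes \<Omega> :: "(real oct^2) set"
  assumes open_\<Omega>: "open \<Omega>"
begin

lemma pd_cong:
  assumes "\<And>y. y \<in> \<Omega> \<Longrightarrow> F y = G y" "x \<in> \<Omega>"
  shows "pd j a F x = pd j a G x"
  unfolding pd_def
proof (rule vector_derivative_cong_eq)
  have "((\<lambda>t. x + t *\<^sub>R axis j (axis a 1)) \<longlongrightarrow> x + 0 *\<^sub>R axis j (axis a 1)) (nhds 0)"
    by (intro tendsto_intros filterlim_ident)
  then have "\<forall>\<^sub>F t in nhds 0. x + t *\<^sub>R axis j (axis a 1) \<in> \<Omega>"
    using topological_tendstoD[OF _ open_\<Omega>] assms(2) by fastforce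
  then show "\<forall>\<^sub>F t in nhds 0. t \<in> UNIV \<longrightarrow> F (x + t *\<^sub>R axis j (axis a 1)) = G (x + t *\<^sub>R axis j (axis a 1))"
    by eventually_elim (simp add: assms(1))
qed auto

lemma smooth_differentiable: "smooth \<Omega> F \<Longrightarrow> x \<in> \<Omega> \<Longrightarrow> F differentiable (at x)"
  using open_\<Omega> unfolding smooth_def
  by (metis differentiable_on_eq_differentiable_at fold_simps(1))

lemma smooth_pd: "smooth \<Omega> F \<Longrightarrow> smooth \<Omega> (pd j a F)"
  unfolding smooth_def
proof
  fix js
  assume "\<forall>js. fold (\<lambda>(j, a). pd j a) js F differentiable_on \<Omega>"
  then have "fold (\<lambda>(j, a). pd j a) ((j, a) # js) F differentiable_on \<Omega>" by blast
  then show "fold (\<lambda>(j, a). pd j a) js (pd j a F) differentiable_on \<Omega>" by simp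
qed

text \<open>
  A coinduction principle: a family of differentiable functions is smooth if it is closed, up to
  equality on \<open>\<Omega>\<close>, under partial derivatives.
\<close>

lemma smooth_family:
  assumes "i \<in> I"
    and diff: "\<And>i x. i \<in> I \<Longrightarrow> x \<in> \<Omega> \<Longrightarrow> \<Phi> i differentiable (at x)"
    and step: "\<And>i j a. i \<in> I \<Longrightarrow> \<exists>i'\<in>I. \<forall>x\<in>\<Omega>. pd j a (\<Phi> i) x = \<Phi> i' x"
  shows "smooth \<Omega> (\<Phi> i)"
proof -
  have "fold (\<lambda>(j, a). pd j a) js F differentiable_on \<Omega>"
    if "i \<in> I" "\<And>x. x \<in> \<Omega> \<Longrightarrow> F x = \<Phi> i x" for js F i
    using that
  proof (induction js arbitrary: F i)
    case Nil
    have "F differentiable (at x within \<Omega>)" if "x \<in> \<Omega>" for x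
      using differentiable_transform_within[of "\<Phi> i" x \<Omega> 1 F] Nil.prems(2) that
        differentiable_at_withinI[OF diff[OF Nil.prems(1) that]] by simp
    then show ?case by (simp add: differentiable_on_def)
  next
    case (Cons p js)
    obtain j a where p: "p = (j, a)" by fastforce
    obtain i' where i': "i' \<in> I" "\<And>x. x \<in> \<Omega> \<Longrightarrow> pd j a (\<Phi> i) x = \<Phi> i' x"
      using step[OF Cons.prems(1)] by blast
    have "pd j a F x = \<Phi> i' x" if "x \<in> \<Omega>" for x
      using pd_cong[of F "\<Phi> i" x j a] Cons.prems(2) i'(2) that by simp
    then show ?case using Cons.IH[OF i'(1)] by (simp add: p)
  qed
  then show ?thesis using assms(1) by (auto simp: smooth_def)
qed

lemma smooth_linear:
  fixes L :: "'v::real_normed_vector \<Rightarrow> 'w::real_normed_vector"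
  assumes L: "bounded_linear L" and F: "smooth \<Omega> F"
  shows "smooth \<Omega> (\<lambda>x. L (F x))"
proof (rule smooth_family[where I = "Collect (smooth \<Omega>)" and \<Phi> = "\<lambda>F x. L (F x)"])
  fix F :: "real oct^2 \<Rightarrow> 'v" and x assume "F \<in> Collect (smooth \<Omega>)" "x \<in> \<Omega>"
  then show "(\<lambda>x. L (F x)) differentiable (at x)"
    using bounded_linear.has_derivative[OF L] smooth_differentiable[of F x]
    unfolding differentiable_def by blast
next
  fix F :: "real oct^2 \<Rightarrow> 'v" and j a assume "F \<in> Collect (smooth \<Omega>)"
  then show "\<exists>G\<in>Collect (smooth \<Omega>). \<forall>x\<in>\<Omega>. pd j a (\<lambda>x. L (F x)) x = L (G x)"
    using pd_linear[OF L smooth_differentiable] smooth_pd by (intro bexI[of _ "pd j a F"]) auto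
qed (use F in simp)

lemma smooth_add:
  fixes F G :: "real oct^2 \<Rightarrow> 'v::real_normed_vector"
  assumes F: "smooth \<Omega> F" and G: "smooth \<Omega> G"
  shows "smooth \<Omega> (\<lambda>x. F x + G x)"
proof -
  define I where "I = {p :: (real oct^2 \<Rightarrow> 'v) \<times> (real oct^2 \<Rightarrow> 'v). smooth \<Omega> (fst p) \<and> smooth \<Omega> (snd p)}"
  have "smooth \<Omega> ((\<lambda>p x. fst p x + snd p x) (F, G))"
  proof (rule smooth_family[where I = I])
    fix p x assume "p \<in> I" "x \<in> \<Omega>"
    then show "(\<lambda>x. fst p x + snd p x) differentiable (at x)"
      using smooth_differentiable by (auto simp: I_def intro!: differentiable_add)
  next
    fix p j a assume p: "p \<in> I"
    have "\<forall>x\<in>\<Omega>. pd j a (\<lambda>x. fst p x + snd p x) x = pd j a (fst p) x + pd j a (snd p) x"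
      using p by (auto simp: I_def intro!: pd_add smooth_differentiable)
    moreover have "(pd j a (fst p), pd j a (snd p)) \<in> I"
      using p by (simp add: I_def smooth_pd)
    ultimately show "\<exists>q\<in>I. \<forall>x\<in>\<Omega>. pd j a (\<lambda>x. fst p x + snd p x) x = fst q x + snd q x"
      by force
  qed (use F G in \<open>simp add: I_def\<close>)
  then show ?thesis by simp
qed

text \<open>
  The quotient \<open>Q\<close> below is unchanged when the two directions are exchanged, and has both iterated
  derivatives as limits.
\<close>

lemma pd_commute_real:
  fixes f :: "real oct^2 \<Rightarrow> real"
  assumes f: "smooth \<Omega> f" and x: "x \<in> \<Omega>"
  shows "pd j a (pd k b f) x = pd k b (pd j a f) x"
proof -
  let ?e = "\<lambda>j a. axis j (axis a 1) :: real oct^2"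
  define Q where "Q j a k b h = (f (x + h *\<^sub>R ?e j a + h *\<^sub>R ?e k b) - f (x + h *\<^sub>R ?e j a)
      - f (x + h *\<^sub>R ?e k b) + f x) / h\<^sup>2" for j a k b h
  have lim: "(Q j a k b \<longlongrightarrow> pd k b (pd j a f) x) (at_right 0)" for j a k b
  proof -
    obtain G where G: "(pd j a f has_derivative G) (at x)"
      using smooth_differentiable[OF smooth_pd[OF f] x] by (auto simp: differentiable_def)
    have "((\<lambda>t. f (y + t *\<^sub>R ?e j a)) has_real_derivative pd j a f y) (at 0)" if y: "y \<in> \<Omega>" for y
    proof -
      obtain F' where F': "(f has_derivative F') (at y)"
        using smooth_differentiable[OF f y] by (auto simp: differentiable_def)
      show ?thesis
        using pd_has_derivative(1)[OF F', of j a]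
        unfolding pd_has_derivative(2)[OF F'] has_real_derivative_iff_has_vector_derivative .
    qed
    then show ?thesis
      using second_difference_quotient[OF open_\<Omega> x _ G, where u = "?e j a" and v = "?e k b"]
      unfolding Q_def pd_has_derivative(2)[OF G] by blast
  qed
  have "Q k b j a h = Q j a k b h" for h
  proof -
    have "x + h *\<^sub>R ?e k b + h *\<^sub>R ?e j a = x + h *\<^sub>R ?e j a + h *\<^sub>R ?e k b"
      by (simp only: ac_simps)
    then have "f (x + h *\<^sub>R ?e k b + h *\<^sub>R ?e j a) = f (x + h *\<^sub>R ?e j a + h *\<^sub>R ?e k b)"
      by (rule arg_cong)
    then show ?thesis by (simp add: Q_def)
  qed
  then have "Q k b j a = Q j a k b" by (rule ext)
  then show ?thesis
    using tendsto_unique[OF trivial_limit_at_right_real lim[of k b j a]] lim[of j a k b] by simp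
qed

lemma pd_commute:
  fixes F :: "real oct^2 \<Rightarrow> 'v::euclidean_space"
  assumes F: "smooth \<Omega> F" and x: "x \<in> \<Omega>"
  shows "pd j a (pd k b F) x = pd k b (pd j a F) x"
proof (rule euclidean_eqI)
  fix e :: 'v
  have inner: "pd j a (pd k b F) x \<bullet> e = pd j a (pd k b (\<lambda>y. F y \<bullet> e)) x" for j a k b
  proof -
    have L: "bounded_linear (\<lambda>v. v \<bullet> e)" by (rule bounded_linear_inner_left)
    have "pd j a (pd k b (\<lambda>y. F y \<bullet> e)) x = pd j a (\<lambda>y. pd k b F y \<bullet> e) x"
      by (rule pd_cong[OF pd_linear[OF L smooth_differentiable[OF F]] x])
    also have "\<dots> = pd j a (pd k b F) x \<bullet> e"
      by (rule pd_linear[OF L smooth_differentiable[OF smooth_pd[OF F] x]])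
    finally show ?thesis by simp
  qed
  have "smooth \<Omega> (\<lambda>y. F y \<bullet> e)"
    by (rule smooth_linear[OF bounded_linear_inner_left F])
  then show "pd j a (pd k b F) x \<bullet> e = pd k b (pd j a F) x \<bullet> e"
    unfolding inner by (rule pd_commute_real[OF _ x])
qed


abbreviation pds :: "(2 \<times> 8) list \<Rightarrow> (real oct^2 \<Rightarrow> 'v::real_normed_vector) \<Rightarrow> real oct^2 \<Rightarrow> 'v" where
  "pds js F \<equiv> fold (\<lambda>(j, a). pd j a) js F"

lemma pds_cong: "(\<And>x. x \<in> \<Omega> \<Longrightarrow> F x = G x) \<Longrightarrow> x \<in> \<Omega> \<Longrightarrow> pds js F x = pds js G x"
proof (induction js arbitrary: F G)
  case (Cons p js)
  obtain j a where p: "p = (j, a)" by fastforce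
  have "pds js (pd j a F) x = pds js (pd j a G) x"
    using Cons.prems by (intro Cons.IH pd_cong[of F G])
  then show ?case by (simp add: p)
qed simp

lemma pd_pds_commute:
  fixes F :: "real oct^2 \<Rightarrow> 'v::euclidean_space"
  assumes "smooth \<Omega> F" "x \<in> \<Omega>"
  shows "pd j a (pds js F) x = pds js (pd j a F) x"
  using assms
proof (induction js arbitrary: F)
  case (Cons p js)
  obtain k b where p: "p = (k, b)" by fastforce
  have "pd j a (pds js (pd k b F)) x = pds js (pd j a (pd k b F)) x"
    by (rule Cons.IH[OF smooth_pd[OF Cons.prems(1)] Cons.prems(2)])
  also have "\<dots> = pds js (pd k b (pd j a F)) x"
    by (rule pds_cong[OF pd_commute[OF Cons.prems(1)] Cons.prems(2)])
  finally show ?case by (simp add: p)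
qed simp

lemma pds_mset_cong:
  fixes F :: "real oct^2 \<Rightarrow> 'v::euclidean_space"
  assumes "mset js = mset js'" "smooth \<Omega> F" "x \<in> \<Omega>"
  shows "pds js F x = pds js' F x"
  using assms
proof (induction js arbitrary: js' F)
  case (Cons p js)
  obtain j a where p: "p = (j, a)" by fastforce
  have "p \<in> set js'" using Cons.prems(1) by (metis list.set_intros(1) set_mset_mset)
  then obtain ks ls where js': "js' = ks @ p # ls" by (meson split_list)
  then have ms: "mset js = mset (ks @ ls)" using Cons.prems(1) by simp
  have "pds js' F x = pds ls (pd j a (pds ks F)) x" by (simp add: js' p)
  also have "\<dots> = pds ls (pds ks (pd j a F)) x"
    by (rule pds_cong[OF pd_pds_commute[OF Cons.prems(2)] Cons.prems(3)])
  also have "\<dots> = pds (ks @ ls) (pd j a F) x" by simp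
  also have "\<dots> = pds js (pd j a F) x"
    by (rule Cons.IH[OF ms smooth_pd[OF Cons.prems(2)] Cons.prems(3), symmetric])
  finally show ?case by (simp add: p)
qed simp

lemma pds_linear:
  assumes L: "bounded_linear L" and "smooth \<Omega> F" "x \<in> \<Omega>"
  shows "pds js (\<lambda>y. L (F y)) x = L (pds js F x)"
  using assms(2,3)
proof (induction js arbitrary: F)
  case (Cons p js)
  obtain j a where p: "p = (j, a)" by fastforce
  have "pds js (pd j a (\<lambda>y. L (F y))) x = pds js (\<lambda>y. L (pd j a F y)) x"
    by (rule pds_cong[OF pd_linear[OF L smooth_differentiable[OF Cons.prems(1)]] Cons.prems(2)])
  also have "\<dots> = L (pds js (pd j a F) x)"
    by (rule Cons.IH[OF smooth_pd[OF Cons.prems(1)] Cons.prems(2)])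
  finally show ?case by (simp add: p)
qed simp

lemma pds_add:
  assumes "smooth \<Omega> F" "smooth \<Omega> G" "x \<in> \<Omega>"
  shows "pds js (\<lambda>y. F y + G y) x = pds js F x + pds js G x"
  using assms
proof (induction js arbitrary: F G)
  case (Cons p js)
  obtain j a where p: "p = (j, a)" by fastforce
  have "pds js (pd j a (\<lambda>y. F y + G y)) x = pds js (\<lambda>y. pd j a F y + pd j a G y) x"
    by (rule pds_cong[OF pd_add[OF smooth_differentiable[OF Cons.prems(1)]
         smooth_differentiable[OF Cons.prems(2)]] Cons.prems(3)])
  also have "\<dots> = pds js (pd j a F) x + pds js (pd j a G) x"
    by (rule Cons.IH[OF smooth_pd[OF Cons.prems(1)] smooth_pd[OF Cons.prems(2)] Cons.prems(3)])
  finally show ?case by (simp add: p)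
qed simp

end


section \<open>Jets\<close>

text \<open>
  The order in which the derivatives are taken is arbitrary; \<open>pds_mset_cong\<close> shows that it does not
  matter when \<open>F\<close> is smooth on an open set containing \<open>x\<close>.
\<close>

definition jet :: "real oct^2 \<Rightarrow> (real oct^2 \<Rightarrow> 'v::real_normed_vector) \<Rightarrow> (2 \<times> 8) multiset \<Rightarrow> 'v" where
  "jet x F M = fold (\<lambda>(j, a). pd j a) (SOME js. mset js = M) F x"

definition shift :: "((2 \<times> 8) multiset, real) partials" where
  "shift j a g M = g (add_mset (j, a) M)"

lemma commuting_partials_shift: "commuting_partials shift"
  by standard (auto simp: shift_def fun_eq_iff add_mset_commute)

lemma jet_empty: "jet x F {#} = F x"
  by (simp add: jet_def)

text \<open>
  Smoothness and the value of the jet are recorded together because the closure rules for the one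
  need the other. The rules below lift a formula in partial derivatives to the same formula in shifts.
\<close>

definition is_jet :: "(real oct^2) set \<Rightarrow> real oct^2 \<Rightarrow> (real oct^2 \<Rightarrow> 'v::real_normed_vector)
    \<Rightarrow> ((2 \<times> 8) multiset \<Rightarrow> 'v) \<Rightarrow> bool" where
  "is_jet \<Omega> x F g \<longleftrightarrow> smooth \<Omega> F \<and> jet x F = g"

lemma is_jet_jet: "smooth \<Omega> F \<Longrightarrow> is_jet \<Omega> x F (jet x F)"
  by (simp add: is_jet_def)

context
  fixes \<Omega> :: "(real oct^2) set" and x :: "real oct^2"
  assumes open_\<Omega>: "open \<Omega>" and x: "x \<in> \<Omega>"
begin

lemma is_jet_linear:
  assumes "bounded_linear L" "is_jet \<Omega> x F g"
  shows "is_jet \<Omega> x (\<lambda>y. L (F y)) (\<lambda>M. L (g M))"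
  using assms by (auto simp: is_jet_def jet_def fun_eq_iff smooth_linear[OF open_\<Omega>] pds_linear[OF open_\<Omega> _ _ x])

lemma is_jet_add:
  assumes "is_jet \<Omega> x F g" "is_jet \<Omega> x G h"
  shows "is_jet \<Omega> x (\<lambda>y. F y + G y) (\<lambda>M. g M + h M)"
  using assms by (auto simp: is_jet_def jet_def fun_eq_iff smooth_add[OF open_\<Omega>] pds_add[OF open_\<Omega> _ _ x])

lemma is_jet_cong:
  assumes "is_jet \<Omega> x F g" "\<And>y. y \<in> \<Omega> \<Longrightarrow> F y = G y"
  shows "is_jet \<Omega> x G g"
proof -
  have "pds js G differentiable (at y within \<Omega>)" if "y \<in> \<Omega>" for js y
  proof (rule differentiable_transform_within[where d = 1])
    show "pds js F differentiable (at y within \<Omega>)"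
      using assms(1) that by (simp add: is_jet_def smooth_def differentiable_on_def)
    show "pds js F z = pds js G z" if "z \<in> \<Omega>" for z
      using pds_cong[OF open_\<Omega> assms(2) that] .
  qed (use that in auto)
  then have "smooth \<Omega> G" by (simp add: smooth_def differentiable_on_def)
  moreover have "jet x G = jet x F"
    unfolding jet_def by (rule ext, rule pds_cong[OF open_\<Omega> _ x]) (simp add: assms(2))
  ultimately show ?thesis using assms(1) by (simp add: is_jet_def)
qed

lemma is_jet_pd:
  fixes F :: "real oct^2 \<Rightarrow> 'v::euclidean_space"
  assumes "is_jet \<Omega> x F g"
  shows "is_jet \<Omega> x (pd j a F) (\<lambda>M. g (add_mset (j, a) M))"
proof -
  have F: "smooth \<Omega> F" and g: "g = jet x F" using assms by (auto simp: is_jet_def)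
  have "jet x (pd j a F) M = jet x F (add_mset (j, a) M)" for M
  proof -
    let ?js = "SOME js. mset js = M" and ?ks = "SOME ks. mset ks = add_mset (j, a) M"
    have "mset ?js = M" "mset ?ks = add_mset (j, a) M" by (rule someI_ex[OF ex_mset])+
    then have "mset ((j, a) # ?js) = mset ?ks" by simp
    then have "fold (\<lambda>(j, a). pd j a) ((j, a) # ?js) F x = fold (\<lambda>(j, a). pd j a) ?ks F x"
      by (rule pds_mset_cong[OF open_\<Omega> _ F x])
    then show ?thesis by (simp add: jet_def)
  qed
  then show ?thesis using smooth_pd[OF open_\<Omega> F] by (auto simp: is_jet_def g)
qed

lemma is_jet_partial: "is_jet \<Omega> x f g \<Longrightarrow> is_jet \<Omega> x (pd j a f) (shift j a g)"
  using is_jet_pd[of f g j a] by (simp add: shift_def[abs_def])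

lemma is_jet_odiff:
  assumes "is_jet \<Omega> x F g"
  shows "is_jet \<Omega> x (odiff pd j a F) (odiff shift j a g)"
proof -
  have F: "smooth \<Omega> F" using assms by (simp add: is_jet_def)
  have "odiff pd j a F y = pd j a F y" if "y \<in> \<Omega>" for y
    using pd_linear[OF bounded_linear_vec_nth smooth_differentiable[OF open_\<Omega> F that]]
    by (simp add: odiff_def vec_eq_iff)
  moreover have "odiff shift j a g = (\<lambda>M. g (add_mset (j, a) M))"
    by (simp add: odiff_def shift_def fun_eq_iff vec_eq_iff)
  ultimately show ?thesis using is_jet_cong[OF is_jet_pd[OF assms]] by simp
qed

lemma is_jet_olinear:
  fixes L :: "real oct \<Rightarrow> real oct"
  assumes "Modules.additive L" "\<And>c v. L (c *s v) = c *s L v" "is_jet \<Omega> x F g"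
  shows "is_jet \<Omega> x (\<lambda>y. L (F y)) (\<lambda>M. L (g M))"
proof -
  have "linear L"
    using assms(1,2) by (intro linearI) (auto simp: Modules.additive_def scalar_mult_eq_scaleR)
  then show ?thesis using is_jet_linear[OF _ assms(3)] by (simp add: linear_conv_bounded_linear)
qed

lemma is_jet_omult:
  fixes c :: "real oct"
  assumes "is_jet \<Omega> x F g"
  shows "is_jet \<Omega> x (\<lambda>y. c \<odot> F y) (\<lambda>M. c \<odot> g M)" "is_jet \<Omega> x (\<lambda>y. F y \<odot> c) (\<lambda>M. g M \<odot> c)"
  using assms by (auto intro!: is_jet_olinear[where L = "\<lambda>z. c \<odot> z"] is_jet_olinear[where L = "\<lambda>z. z \<odot> c"]
     simp: additive_omult_left additive_omult_right omult_scale_left omult_scale_right)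

lemma is_jet_ocnj:
  fixes F :: "real oct^2 \<Rightarrow> real oct"
  shows "is_jet \<Omega> x F g \<Longrightarrow> is_jet \<Omega> x (\<lambda>y. ocnj (F y)) (\<lambda>M. ocnj (g M))"
  by (rule is_jet_olinear[where L = ocnj]) (simp_all add: additive_ocnj ocnj_scale)

lemma is_jet_oIm:
  fixes F :: "real oct^2 \<Rightarrow> real oct"
  shows "is_jet \<Omega> x F g \<Longrightarrow> is_jet \<Omega> x (\<lambda>y. oIm (F y)) (\<lambda>M. oIm (g M))"
  by (rule is_jet_olinear[where L = oIm]) (simp_all add: Modules.additive_def oIm_add oIm_scale)

lemma is_jet_oRe: "is_jet \<Omega> x F g \<Longrightarrow> is_jet \<Omega> x (\<lambda>y. oRe (F y)) (\<lambda>M. oRe (g M))"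
  unfolding oRe_def by (rule is_jet_linear[OF bounded_linear_vec_nth])

lemma is_jet_nth: "is_jet \<Omega> x F g \<Longrightarrow> is_jet \<Omega> x (\<lambda>y. F y $ k) (\<lambda>M. g M $ k)"
  by (rule is_jet_linear[OF bounded_linear_vec_nth])

lemma is_jet_scaleR: "is_jet \<Omega> x F g \<Longrightarrow> is_jet \<Omega> x (\<lambda>y. c *\<^sub>R F y) (\<lambda>M. c *\<^sub>R g M)"
  by (rule is_jet_linear[OF bounded_linear_scaleR_right])

lemma is_jet_minus: "is_jet \<Omega> x F g \<Longrightarrow> is_jet \<Omega> x (\<lambda>y. - F y) (\<lambda>M. - g M)"
  by (rule is_jet_linear[OF bounded_linear_minus[OF bounded_linear_ident]])

lemma is_jet_diff: "is_jet \<Omega> x F g \<Longrightarrow> is_jet \<Omega> x G h \<Longrightarrow> is_jet \<Omega> x (\<lambda>y. F y - G y) (\<lambda>M. g M - h M)"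
  using is_jet_add[OF _ is_jet_minus[of G h]] by simp

lemma linear_axis: "linear (axis k :: 'v::real_vector \<Rightarrow> 'v^'n)"
  by (intro linearI) (simp_all add: axis_def vec_eq_iff)

lemma is_jet_oscalar:
  fixes f :: "real oct^2 \<Rightarrow> real"
  shows "is_jet \<Omega> x f g \<Longrightarrow> is_jet \<Omega> x (\<lambda>y. oscalar (f y)) (\<lambda>M. oscalar (g M))"
  unfolding oscalar_def
  by (rule is_jet_linear[OF linear_conv_bounded_linear[THEN iffD1, OF linear_axis]])

lemma is_jet_vector2:
  fixes F :: "real oct^2 \<Rightarrow> 'v::euclidean_space"
  assumes "is_jet \<Omega> x F g" "is_jet \<Omega> x G h"
  shows "is_jet \<Omega> x (\<lambda>y. vector [F y, G y] :: 'v^2) (\<lambda>M. vector [g M, h M])"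
proof -
  have v: "(vector [p, q] :: 'v^2) = axis 1 p + axis 2 q" for p q
    by (simp add: vec2_eq_iff axis_def)
  have ax: "bounded_linear (axis k :: 'v \<Rightarrow> 'v^2)" for k
    by (rule linear_conv_bounded_linear[THEN iffD1, OF linear_axis])
  show ?thesis
    unfolding v by (rule is_jet_add[OF is_jet_linear[OF ax assms(1)] is_jet_linear[OF ax assms(2)]])
qed

lemma is_jet_sum:
  assumes "\<And>a. is_jet \<Omega> x (F a) (g a)"
  shows "is_jet \<Omega> x (\<lambda>y. \<Sum>a\<in>A. F a y) (\<lambda>M. \<Sum>a\<in>A. g a M)"
proof -
  have zero: "is_jet \<Omega> x (\<lambda>y. 0) (\<lambda>M. 0)"
    using is_jet_linear[OF bounded_linear_zero assms] .
  show ?thesis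
  proof (induction A rule: infinite_finite_induct)
    case (insert a A)
    then show ?case using is_jet_add[OF assms insert.IH] by (simp only: sum.insert not_False_eq_True)
  qed (use zero in simp_all)
qed

lemmas is_jet_intros = is_jet_sum is_jet_omult is_jet_odiff is_jet_ocnj is_jet_oIm is_jet_oRe is_jet_nth
  is_jet_scaleR is_jet_minus is_jet_diff is_jet_add is_jet_oscalar is_jet_vector2 is_jet_partial

end

context
  fixes \<Omega> :: "(real oct^2) set" and x :: "real oct^2"
  assumes open_\<Omega>: "open \<Omega>" and x: "x \<in> \<Omega>"
begin

lemmas jet_rules = is_jet_intros[OF open_\<Omega> x]

lemma is_jet_dbar: "is_jet \<Omega> x F g \<Longrightarrow> is_jet \<Omega> x (dbar pd j F) (dbar shift j g)"
  and is_jet_dunbar: "is_jet \<Omega> x F g \<Longrightarrow> is_jet \<Omega> x (dunbar pd j F) (dunbar shift j g)"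
  and is_jet_rdbar: "is_jet \<Omega> x F g \<Longrightarrow> is_jet \<Omega> x (rdbar pd j F) (rdbar shift j g)"
  and is_jet_rdunbar: "is_jet \<Omega> x F g \<Longrightarrow> is_jet \<Omega> x (rdunbar pd j F) (rdunbar shift j g)"
  and is_jet_dmixed: "is_jet \<Omega> x F g \<Longrightarrow> is_jet \<Omega> x (dmixed pd i j F) (dmixed shift i j g)"
  unfolding dbar_def dunbar_def rdbar_def rdunbar_def dmixed_def
  by (intro jet_rules; assumption)+

lemma is_jet_laplace: "is_jet \<Omega> x f g \<Longrightarrow> is_jet \<Omega> x (laplace pd j f) (laplace shift j g)"
  unfolding laplace_def by (intro jet_rules; assumption)

lemmas jet_op_rules = jet_rules is_jet_dbar is_jet_dunbar is_jet_rdbar is_jet_rdunbar is_jet_dmixed is_jet_laplace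

lemma is_jet_D0: "is_jet \<Omega> x f g \<Longrightarrow> is_jet \<Omega> x (D0 pd f) (D0 shift g)"
  and is_jet_D1: "is_jet \<Omega> x u w \<Longrightarrow> is_jet \<Omega> x (D1 pd u) (D1 shift w)"
  and is_jet_D2: "is_jet \<Omega> x v z \<Longrightarrow> is_jet \<Omega> x (D2 pd v) (D2 shift z)"
  and is_jet_D3: "is_jet \<Omega> x v z \<Longrightarrow> is_jet \<Omega> x (D3 pd v) (D3 shift z)"
  unfolding D0_def D1_def D2_def D3_def
  by (intro jet_op_rules; assumption)+

lemma is_jet_D4: "is_jet \<Omega> x u w \<Longrightarrow> is_jet \<Omega> x (D4 pd u) (D4 shift w)"
proof -
  assume u: "is_jet \<Omega> x u w"
  have "D4 pd u = (\<lambda>x. laplace pd 1 (\<lambda>y. oRe (u y $ 1 $ 1)) x + laplace pd 2 (\<lambda>y. oRe (u y $ 2 $ 2)) x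
       + 2 *\<^sub>R oRe (rdbar pd 1 (dunbar pd 2 (\<lambda>y. u y $ 2 $ 1)) x))"
    "D4 shift w = (\<lambda>x. laplace shift 1 (\<lambda>y. oRe (w y $ 1 $ 1)) x + laplace shift 2 (\<lambda>y. oRe (w y $ 2 $ 2)) x
       + 2 *\<^sub>R oRe (rdbar shift 1 (dunbar shift 2 (\<lambda>y. w y $ 2 $ 1)) x))"
    by (simp_all add: D4_def fun_eq_iff)
  then show ?thesis using u by (simp only:) (intro jet_op_rules)
qed

text \<open>
  Jets depend only on the values on \<open>\<Omega>\<close>; this carries the equations of \<open>mem_H2_iff\<close>, which
  sections satisfy only there, over to all entries of the jet.
\<close>

lemma is_jet_eq_0:
  assumes F: "is_jet \<Omega> x F g" and "\<And>y. y \<in> \<Omega> \<Longrightarrow> F y = 0"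
  shows "g M = 0"
proof -
  have "is_jet \<Omega> x (\<lambda>y. 0 *\<^sub>R F y) (\<lambda>M. 0 *\<^sub>R g M)"
    by (intro jet_rules F)
  moreover have "is_jet \<Omega> x (\<lambda>y. 0) g"
    by (rule is_jet_cong[OF open_\<Omega> x F assms(2)])
  ultimately show ?thesis by (simp add: is_jet_def fun_eq_iff)
qed

lemma jet_in_H2:
  fixes u :: "real oct^2 \<Rightarrow> real oct^2^2"
  assumes u: "smooth \<Omega> u" and H2: "\<And>y. y \<in> \<Omega> \<Longrightarrow> u y \<in> H2"
  shows "jet x u M \<in> H2"
proof -
  note j = is_jet_jet[OF u]
  have "oIm (jet x u M $ 1 $ 1) = 0"
    by (rule is_jet_eq_0[of "\<lambda>y. oIm (u y $ 1 $ 1)"]) (intro jet_rules j, use H2 in \<open>simp add: mem_H2_iff\<close>)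
  moreover have "oIm (jet x u M $ 2 $ 2) = 0"
    by (rule is_jet_eq_0[of "\<lambda>y. oIm (u y $ 2 $ 2)"]) (intro jet_rules j, use H2 in \<open>simp add: mem_H2_iff\<close>)
  moreover have "jet x u M $ 2 $ 1 - ocnj (jet x u M $ 1 $ 2) = 0"
    by (rule is_jet_eq_0[of "\<lambda>y. u y $ 2 $ 1 - ocnj (u y $ 1 $ 2)"])
      (intro jet_rules j, use H2 in \<open>simp add: mem_H2_iff\<close>)
  ultimately show ?thesis by (simp add: mem_H2_iff)
qed

lemma is_jet_value: "is_jet \<Omega> x F g \<Longrightarrow> F x = g {#}"
  using jet_empty[of x F] by (simp add: is_jet_def)

lemma is_jet_smooth: "is_jet \<Omega> x F g \<Longrightarrow> smooth \<Omega> F"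
  by (simp add: is_jet_def)

end

section \<open>The complex of smooth sections\<close>

lemma hessian_complex:
  assumes "open \<Omega>" "\<Omega> \<noteq> {}"
  shows "hessian_sequence_is_complex \<Omega>"
proof -
  \<comment> \<open>Smoothness of the images is a statement about \<open>\<Omega>\<close>; jets at an arbitrary point provide it.\<close>
  obtain x0 where x0: "x0 \<in> \<Omega>" using assms(2) by blast
  note J = is_jet_D0[OF assms(1)] is_jet_D1[OF assms(1)] is_jet_D2[OF assms(1)] is_jet_D3[OF assms(1)]
    is_jet_D4[OF assms(1)]
  note smooth = is_jet_smooth[OF assms(1) x0 J(1)[OF x0 is_jet_jet]]
    is_jet_smooth[OF assms(1) x0 J(2)[OF x0 is_jet_jet]] is_jet_smooth[OF assms(1) x0 J(3)[OF x0 is_jet_jet]]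
    is_jet_smooth[OF assms(1) x0 J(4)[OF x0 is_jet_jet]] is_jet_smooth[OF assms(1) x0 J(5)[OF x0 is_jet_jet]]
  note at_point = is_jet_value[OF assms(1)]
  interpret S: commuting_partials shift by (rule commuting_partials_shift)
  have D0_H2: "D0 pd f x \<in> H2" if "smooth \<Omega> f" "x \<in> \<Omega>"
    for f :: "real oct^2 \<Rightarrow> real" and x
    using at_point[OF that(2) J(1)[OF that(2) is_jet_jet[OF that(1)]]] by (simp add: S.D0_in_H2)
  have D3_H2: "D3 pd t x \<in> H2" if "smooth \<Omega> t" "x \<in> \<Omega>"
    for t :: "real oct^2 \<Rightarrow> real oct^2" and x
    using at_point[OF that(2) J(4)[OF that(2) is_jet_jet[OF that(1)]]] by (simp add: S.D3_in_H2)
  have D10: "D1 pd (D0 pd f) x = 0" if "smooth \<Omega> f" "x \<in> \<Omega>"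
    for f :: "real oct^2 \<Rightarrow> real" and x
    using at_point[OF that(2) J(2)[OF that(2) J(1)[OF that(2) is_jet_jet[OF that(1)]]]] by (simp add: S.D1_D0)
  have D21: "D2 pd (D1 pd u) x = 0" if "smooth \<Omega> u" "\<forall>x\<in>\<Omega>. u x \<in> H2" "x \<in> \<Omega>"
    for u :: "real oct^2 \<Rightarrow> real oct^2^2" and x
    using at_point[OF that(3) J(3)[OF that(3) J(2)[OF that(3) is_jet_jet[OF that(1)]]]]
      jet_in_H2[OF assms(1) that(3,1)] that(2) by (simp add: S.D2_D1)
  have D32: "D3 pd (D2 pd v) x = 0" if "smooth \<Omega> v" "x \<in> \<Omega>"
    for v :: "real oct^2 \<Rightarrow> real oct^2" and x
    using at_point[OF that(2) J(4)[OF that(2) J(3)[OF that(2) is_jet_jet[OF that(1)]]]] by (simp add: S.D3_D2)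
  have D43: "D4 pd (D3 pd t) x = 0" if "smooth \<Omega> t" "x \<in> \<Omega>"
    for t :: "real oct^2 \<Rightarrow> real oct^2" and x
    using at_point[OF that(2) J(5)[OF that(2) J(4)[OF that(2) is_jet_jet[OF that(1)]]]] by (simp add: S.D4_D3)
  show ?thesis
    unfolding hessian_sequence_is_complex_def Gam_def V0_def V1_def V2_def V3_def V4_def V5_def
    using smooth D0_H2 D3_H2 D10 D21 D32 D43 by auto
qed

theorem theorem1p1:
  fixes \<Omega> :: "(real oct^2) set"
  assumes "open \<Omega>" and "connected \<Omega>" and "\<Omega> \<noteq> {}"
  shows "hessian_sequence_is_complex \<Omega> \<and>
    (\<forall>\<xi> :: real oct^2. \<xi> \<noteq> 0 \<longrightarrow> symbol_sequence_exact \<xi>)"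
  using hessian_complex[OF assms(1,3)] symbol_exact by blast

end
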